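(* Consider the control affine system $\dot x = g(x,u) = f_0(x)+\sum_{j=1}^{n-1}u_jf_j(x)$ on an $n$-dimensional manifold $X$. Let $(x_0,u_0)\in X\times\mathbb R^{n-1}$ and $k\in\{1,\dots,n-1\}$ be such that $$\dim\big(\mathrm{Span}\{f_1,\dots,f_{n-1},[g,f_k]\}\big)=n$$ at every point $(x,u)$ of an open neighborhood of $(x_0,u_0)$. Then every $(n-1)$-tuple of first integrals of $f_k$, independent at $(x_0,u_0)$, forms a vector of flat outputs in an open neighborhood of $(x_0,u_0)$.
   Context: **System.** $X$ is a smooth manifold of dimension $n\ge 2$. The system is given, in a local chart, by $\dot x=g(x,u)\triangleq f_0(x)+\sum_{j=1}^{n-1}u_jf_j(x)$, with state $x\in X$, control $u=(u_1,\dots,u_{n-1})\in\mathbb R^{n-1}$, and $C^\infty$ vector fields. The vector fields $f_1,\dots,f_{n-1}$ are linearly independent on a dense open subset of $X$. Lie bracket convention: $[\eta,\gamma]=\frac{\partial\gamma}{\partial x}\eta-\frac{\partial\eta}{\partial x}\gamma$. In $[g,f_k]$ the bracket is taken with respect to $x$, with $u$ a constant parameter. **First integrals.** A first integral of $f_k$ is a smooth function $\psi$ of $x$, defined near $x_0$, with $L_{f_k}\psi=0$ ($L$ is the Lie derivative). First integrals $\psi_{0,1},\dots,\psi_{0,n-1}$ are independent if their differentials are linearly independent at the point considered. **Infinite jets.** $\mathbb R^{m}_\infty=\mathbb R^m\times\mathbb R^m\times\cdots$ with the product topology. $\mathfrak X=X\times\mathbb R^{n-1}_\infty$ has coordinates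 $(x,\overline u)=(x,u^{(0)},u^{(1)},\dots)$, with $u^{(0)}=u$. Smooth functions depend (locally) on finitely many coordinates and are smooth in them. $\mathfrak X$ is endowed with the Cartan field $C_g=g(x,u)\frac{\partial}{\partial x}+\sum_{j\ge0}u^{(j+1)}\frac{\partial}{\partial u^{(j)}}$. **Flat outputs.** A $\mathbb R^{n-1}$-valued smooth function $z$ of $(x,\overline u)$ is a (vector of) flat output(s) near a point of $\mathfrak X$ if the map $(x,\overline u)\mapsto(z,C_gz,C_g^2z,\dots)\in\mathbb R^{n-1}_\infty$ (where $C_g^jz$ is the $j$-th time derivative of $z$ along the system) is, near that point, a local $C^\infty$ isomorphism with $C^\infty$ inverse. This map then carries $C_g$ to the trivial Cartan field $\tau=\sum_{j\ge0}\sum_{i=1}^{n-1}z_i^{(j+1)}\frac{\partial}{\partial z_i^{(j)}}$. In particular $x$ and $\overline u$ are locally smooth functions of $z$ and finitely many of its time derivatives. An open neighborhood of $(x_0,u_0)$ in $X\times\mathbb R^{n-1}$ is identified with the corresponding open set of $\mathfrak X$ of all points $(x,\overline u)$ whose projection $(x,u^{(0)})$ lies in it. *)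

theory Defs
  imports "HOL-Analysis.Analysis" "HOL-Library.Function_Algebras"
begin

primrec ck_on ::
  "nat \<Rightarrow> 'a::euclidean_space set \<Rightarrow> ('a \<Rightarrow> 'b::real_normed_vector) \<Rightarrow> bool" where
  "ck_on 0 S f \<longleftrightarrow> continuous_on S f"
| "ck_on (Suc r) S f \<longleftrightarrow>
     (\<forall>x\<in>S. f differentiable (at x)) \<and> (\<forall>v. ck_on r S (\<lambda>x. frechet_derivative f (at x) v))"

definition smooth_on :: "'a::euclidean_space set \<Rightarrow> ('a \<Rightarrow> 'b::real_normed_vector) \<Rightarrow> bool" where
  "smooth_on S f \<longleftrightarrow> (\<forall>r. ck_on r S f)"

definition lie_bracket ::
  "('v::euclidean_space \<Rightarrow> 'v) \<Rightarrow> ('v \<Rightarrow> 'v) \<Rightarrow> 'v \<Rightarrow> 'v" where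
  "lie_bracket \<eta> \<gamma> \<xi> =
     frechet_derivative \<gamma> (at \<xi>) (\<eta> \<xi>) - frechet_derivative \<eta> (at \<xi>) (\<gamma> \<xi>)"

definition lie_derivative ::
  "('v::euclidean_space \<Rightarrow> 'v) \<Rightarrow> ('v \<Rightarrow> real) \<Rightarrow> 'v \<Rightarrow> real" where
  "lie_derivative \<eta> h \<xi> = frechet_derivative h (at \<xi>) (\<eta> \<xi>)"

text \<open>
  Pointwise real vector space structure on functions. It is used on the infinite product of
  copies of the control space, and on spaces of linear functionals.
\<close>

instantiation "fun" :: (type, real_vector) real_vector
begin

definition scaleR_fun :: "real \<Rightarrow> ('a \<Rightarrow> 'b) \<Rightarrow> 'a \<Rightarrow> 'b" where
  "scaleR_fun c f = (\<lambda>x. c *\<^sub>R f x)"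

instance
  by standard (simp_all add: scaleR_fun_def fun_eq_iff scaleR_add_right scaleR_add_left)

end

definition independent_family :: "('i \<Rightarrow> 'v::real_vector) \<Rightarrow> bool" where
  "independent_family v \<longleftrightarrow> inj v \<and> independent (range v)"

text \<open>
  A chart is a pair of its domain and its coordinate map; the values of the coordinate map
  outside the domain are irrelevant.
\<close>

type_synonym ('a, 'n) chart = "'a set \<times> ('a \<Rightarrow> real ^ 'n)"

abbreviation chart_dom :: "('a, 'n) chart \<Rightarrow> 'a set" where
  "chart_dom c \<equiv> fst c"

abbreviation chart_map :: "('a, 'n) chart \<Rightarrow> 'a \<Rightarrow> real ^ 'n" where
  "chart_map c \<equiv> snd c"

definition chart_inv :: "('a, 'n) chart \<Rightarrow> real ^ 'n \<Rightarrow> 'a" where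
  "chart_inv c = inv_into (chart_dom c) (chart_map c)"

definition smooth_atlas ::
  "('a::{t2_space, second_countable_topology}, 'n::finite) chart set \<Rightarrow> bool" where
  "smooth_atlas A \<longleftrightarrow>
     (\<Union>c\<in>A. chart_dom c) = UNIV \<and>
     (\<forall>c\<in>A. open (chart_dom c) \<and> open (chart_map c ` chart_dom c) \<and>
        homeomorphism (chart_dom c) (chart_map c ` chart_dom c) (chart_map c) (chart_inv c)) \<and>
     (\<forall>c\<in>A. \<forall>d\<in>A. smooth_on (chart_map c ` (chart_dom c \<inter> chart_dom d))
        (chart_map d \<circ> chart_inv c))"

definition smooth_function_on ::
  "('a, 'n::finite) chart set \<Rightarrow> 'a set \<Rightarrow> ('a \<Rightarrow> real) \<Rightarrow> bool" where
  "smooth_function_on A U h \<longleftrightarrow>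
     (\<forall>c\<in>A. smooth_on (chart_map c ` (chart_dom c \<inter> U)) (h \<circ> chart_inv c))"

text \<open>
  A vector field is given by its local expressions: \<open>V c \<xi>\<close> is the vector of components, with
  respect to the chart \<open>c\<close>, at the point with coordinates \<open>\<xi>\<close>. Only values with \<open>c\<close> in the atlas
  and \<open>\<xi>\<close> in the range of \<open>c\<close> matter, and there the local expressions have to be related
  by the differentials of the coordinate changes.
\<close>

type_synonym ('a, 'n) vfield = "('a, 'n) chart \<Rightarrow> real ^ 'n \<Rightarrow> real ^ 'n"

definition smooth_vector_field ::
  "('a, 'n::finite) chart set \<Rightarrow> ('a, 'n) vfield \<Rightarrow> bool" where
  "smooth_vector_field A V \<longleftrightarrow>
     (\<forall>c\<in>A. smooth_on (chart_map c ` chart_dom c) (V c)) \<and>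
     (\<forall>c\<in>A. \<forall>d\<in>A. \<forall>x\<in>chart_dom c \<inter> chart_dom d.
        V d (chart_map d x) =
          frechet_derivative (chart_map d \<circ> chart_inv c) (at (chart_map c x))
            (V c (chart_map c x)))"

text \<open>
  All pointwise notions below are independent of the chart used to express them; they are stated
  for every chart of the atlas around the point.
\<close>

definition first_integral_near ::
  "('a::topological_space, 'n::finite) chart set \<Rightarrow> ('a, 'n) vfield \<Rightarrow> 'a \<Rightarrow> ('a \<Rightarrow> real) \<Rightarrow> bool"
  where
  "first_integral_near A V x\<^sub>0 h \<longleftrightarrow>
     (\<exists>U. open U \<and> x\<^sub>0 \<in> U \<and> smooth_function_on A U h \<and>
       (\<forall>x\<in>U. \<forall>c\<in>A. x \<in> chart_dom c \<longrightarrow>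
          lie_derivative (V c) (h \<circ> chart_inv c) (chart_map c x) = 0))"

definition independent_differentials_at ::
  "('a, 'n::finite) chart set \<Rightarrow> 'a \<Rightarrow> ('i \<Rightarrow> 'a \<Rightarrow> real) \<Rightarrow> bool" where
  "independent_differentials_at A x \<psi> \<longleftrightarrow>
     (\<forall>c\<in>A. x \<in> chart_dom c \<longrightarrow>
        independent_family (\<lambda>i. frechet_derivative (\<psi> i \<circ> chart_inv c) (at (chart_map c x))))"

definition control_affine ::
  "('a, 'n) vfield \<Rightarrow> ('m \<Rightarrow> ('a, 'n) vfield) \<Rightarrow> ('a, 'n) chart \<Rightarrow>
   real ^ 'n \<Rightarrow> real ^ 'm \<Rightarrow> real ^ 'n" where
  "control_affine f\<^sub>0 f c \<xi> u = f\<^sub>0 c \<xi> + (\<Sum>j\<in>UNIV. u $ j *\<^sub>R f j c \<xi>)"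

definition generically_independent ::
  "('a::topological_space, 'n::finite) chart set \<Rightarrow> ('m \<Rightarrow> ('a, 'n) vfield) \<Rightarrow> bool" where
  "generically_independent A f \<longleftrightarrow>
     (\<exists>D. open D \<and> closure D = UNIV \<and>
       (\<forall>x\<in>D. \<forall>c\<in>A. x \<in> chart_dom c \<longrightarrow> independent_family (\<lambda>j. f j c (chart_map c x))))"

text \<open>
  The type \<open>nat \<Rightarrow> real ^ 'm\<close>, with its product topology, is the space of
  sequences \<open>(u\<^sup>(\<^sup>0\<^sup>), u\<^sup>(\<^sup>1\<^sup>), \<dots>)\<close>. It carries no norm, so derivatives are taken in
  directions. A function depending on finitely many coordinates is smooth in them if and only if
  all its iterated directional derivatives exist and are continuous.
\<close>

definition dir_deriv ::
  "('v::real_vector \<Rightarrow> 'b::real_normed_vector) \<Rightarrow> 'v \<Rightarrow> 'v \<Rightarrow> 'b" where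
  "dir_deriv F p v = vector_derivative (\<lambda>t. F (p + t *\<^sub>R v)) (at 0)"

primrec jet_ck_on ::
  "nat \<Rightarrow> 'v::{real_vector, topological_space} set \<Rightarrow> ('v \<Rightarrow> 'b::real_normed_vector) \<Rightarrow> bool"
  where
  "jet_ck_on 0 P F \<longleftrightarrow> continuous_on P F"
| "jet_ck_on (Suc r) P F \<longleftrightarrow>
     (\<forall>p\<in>P. \<forall>v. (\<lambda>t. F (p + t *\<^sub>R v)) differentiable (at (0::real))) \<and>
     (\<forall>v. jet_ck_on r P (\<lambda>p. dir_deriv F p v))"

text \<open>In the following, \<open>coords N p\<close> is the tuple of the first coordinates, up to order \<open>N\<close>.\<close>

definition locally_finite_order_on ::
  "(nat \<Rightarrow> 'v \<Rightarrow> 'w) \<Rightarrow> 'v::topological_space set \<Rightarrow> ('v \<Rightarrow> 'b) \<Rightarrow> bool" where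
  "locally_finite_order_on coords P F \<longleftrightarrow>
     (\<forall>p\<in>P. \<exists>V N. open V \<and> p \<in> V \<and> V \<subseteq> P \<and>
        (\<forall>q\<in>V. \<forall>q'\<in>V. coords N q = coords N q' \<longrightarrow> F q = F q'))"

definition jet_smooth_on ::
  "(nat \<Rightarrow> 'v \<Rightarrow> 'w) \<Rightarrow> 'v::{real_vector, topological_space} set \<Rightarrow>
   ('v \<Rightarrow> 'b::real_normed_vector) \<Rightarrow> bool" where
  "jet_smooth_on coords P F \<longleftrightarrow>
     locally_finite_order_on coords P F \<and> (\<forall>r. jet_ck_on r P F)"

definition out_coords :: "nat \<Rightarrow> (nat \<Rightarrow> 'c) \<Rightarrow> 'c list" where
  "out_coords N \<zeta> = map \<zeta> [0..<Suc N]"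

definition state_coords :: "nat \<Rightarrow> 'v \<times> (nat \<Rightarrow> 'c) \<Rightarrow> 'v \<times> 'c list" where
  "state_coords N p = (fst p, out_coords N (snd p))"

definition cartan_field ::
  "('v \<Rightarrow> 'c \<Rightarrow> 'v) \<Rightarrow> 'v \<times> (nat \<Rightarrow> 'c) \<Rightarrow> 'v \<times> (nat \<Rightarrow> 'c)" where
  "cartan_field G p = (G (fst p) (snd p 0), \<lambda>j. snd p (Suc j))"

text \<open>
  For \<open>F\<close> smooth and of finite order, linearity of the derivative in the direction shows that this is
  the derivation given by \<open>G \<partial>/\<partial>x + (\<Sum>j. u\<^sup>(\<^sup>j\<^sup>+\<^sup>1\<^sup>) \<partial>/\<partial>u\<^sup>(\<^sup>j\<^sup>))\<close>, a locally finite sum.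
\<close>

definition cartan_deriv ::
  "('v::real_vector \<Rightarrow> 'c::real_vector \<Rightarrow> 'v) \<Rightarrow>
   ('v \<times> (nat \<Rightarrow> 'c) \<Rightarrow> 'b::real_normed_vector) \<Rightarrow> 'v \<times> (nat \<Rightarrow> 'c) \<Rightarrow> 'b" where
  "cartan_deriv G F p = dir_deriv F p (cartan_field G p)"

definition prolongation ::
  "('v::real_vector \<Rightarrow> 'c::real_vector \<Rightarrow> 'v) \<Rightarrow>
   ('v \<times> (nat \<Rightarrow> 'c) \<Rightarrow> 'b::real_normed_vector) \<Rightarrow> 'v \<times> (nat \<Rightarrow> 'c) \<Rightarrow> nat \<Rightarrow> 'b" where
  "prolongation G z p = (\<lambda>j. (cartan_deriv G ^^ j) z p)"

text \<open>A map into an infinite product is smooth if each of its components is.\<close>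

definition jet_diffeomorphism ::
  "('v::euclidean_space \<times> (nat \<Rightarrow> 'c::euclidean_space)) set \<Rightarrow> (nat \<Rightarrow> 'b::euclidean_space) set \<Rightarrow>
   ('v \<times> (nat \<Rightarrow> 'c) \<Rightarrow> nat \<Rightarrow> 'b) \<Rightarrow> bool" where
  "jet_diffeomorphism P Q \<Phi> \<longleftrightarrow>
     (\<exists>\<Psi>. homeomorphism P Q \<Phi> \<Psi> \<and>
        (\<forall>j. jet_smooth_on state_coords P (\<lambda>p. \<Phi> p j)) \<and>
        jet_smooth_on out_coords Q (\<lambda>\<zeta>. fst (\<Psi> \<zeta>)) \<and>
        (\<forall>j. jet_smooth_on out_coords Q (\<lambda>\<zeta>. snd (\<Psi> \<zeta>) j)))"

definition flat_output_near ::
  "('a, 'n::finite) chart set \<Rightarrow> ('a, 'n) vfield \<Rightarrow> ('m::finite \<Rightarrow> ('a, 'n) vfield) \<Rightarrow>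
   ('a \<times> (nat \<Rightarrow> real ^ 'm) \<Rightarrow> real ^ 'm) \<Rightarrow> 'a \<times> (nat \<Rightarrow> real ^ 'm) \<Rightarrow> bool" where
  "flat_output_near A f\<^sub>0 f z p \<longleftrightarrow>
     (\<forall>c\<in>A. fst p \<in> chart_dom c \<longrightarrow>
        (\<exists>P Q. open P \<and> open Q \<and> (chart_map c (fst p), snd p) \<in> P \<and>
           P \<subseteq> (chart_map c ` chart_dom c) \<times> UNIV \<and>
           jet_diffeomorphism P Q
             (prolongation (control_affine f\<^sub>0 f c)
               (\<lambda>q. z (chart_inv c (fst q), snd q)))))"

end

theory Submission
  imports Defs
begin

text \<open>
  Write \<open>z = \<psi>(x)\<close> and \<open>z' = d\<psi>(x) g(x, u)\<close> for the time derivative of \<open>z\<close>. As \<open>d\<psi>(f\<^sub>k) = 0\<close>, the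
  control \<open>u\<^sub>k\<close> drops out of \<open>z'\<close>, so that \<open>(z, z')\<close> depends on \<open>x\<close> and on the \<open>n - 2\<close> other
  controls only: as many unknowns as there are components. This map is a local
  diffeomorphism. A vector in the kernel of its differential has its \<open>x\<close>-part in \<open>ker d\<psi>\<close>,
  which is the line spanned by \<open>f\<^sub>k\<close>, and the derivative of \<open>z'\<close> along \<open>f\<^sub>k\<close> is
  \<open>- d\<psi>([g, f\<^sub>k])\<close>, because second derivatives are symmetric and \<open>L\<^bsub>f\<^sub>k\<^esub> \<psi>\<close> vanishes identically.
  Hence the kernel is governed by the images under \<open>d\<psi>\<close> of \<open>f\<^sub>j\<close>, \<open>j \<noteq> k\<close>, and of \<open>[g, f\<^sub>k]\<close>,
  and these are independent by the rank condition, as \<open>ker d\<psi>\<close> is spanned by \<open>f\<^sub>k\<close>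
  (\<open>inj_derivative_\<Phi>\<close>).

  Inverting it, with the smooth inverse function theorem, gives \<open>x\<close> and the \<open>u\<^sub>j\<close> with \<open>j \<noteq> k\<close> as
  smooth functions of \<open>(z, z')\<close>. Differentiating \<open>x\<close> once more gives \<open>u\<^sub>k\<close>: the vector
  \<open>x' - f\<^sub>0 - \<Sum>j\<noteq>k. u\<^sub>j f\<^sub>j\<close> is a multiple of \<open>f\<^sub>k\<close>, and \<open>u\<^sub>k\<close> is the factor. It is a function of
  \<open>(z, z', z'')\<close>. Differentiating along the trivial Cartan field expresses all derivatives of
  \<open>u\<close> by derivatives of \<open>z\<close>. The resulting map \<open>\<Psi>\<close> and the prolongation \<open>Z\<close> each intertwine
  the two Cartan fields (\<open>cartan_deriv_pullback\<close>, \<open>\<tau>_pullback\<close>), so they are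
  mutually inverse as soon as they are on the lowest order coordinates (\<open>\<Psi>_Z\<close>, \<open>Z_\<Psi>\<close>).

  On the infinite jet spaces, smoothness and the chain rule are obtained for one explicit
  algebra of functions: the one generated by the coordinates and by the smooth functions of a
  fixed finite-dimensional projection. It is closed under differentiation along vector fields
  with coefficients in the algebra, and it contains every function that occurs in the argument.
\<close>

section \<open>Smooth maps between Euclidean spaces\<close>

lemma linear_Basis_expansion:
  fixes L :: "'a::euclidean_space \<Rightarrow> 'b::real_vector"
  assumes "linear L"
  shows "L v = (\<Sum>b\<in>Basis. (v \<bullet> b) *\<^sub>R L b)"
proof -
  have "L (\<Sum>b\<in>Basis. (v \<bullet> b) *\<^sub>R b) = (\<Sum>b\<in>Basis. (v \<bullet> b) *\<^sub>R L b)"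
    by (simp add: linear_sum[OF assms] linear_cmul[OF assms])
  then show ?thesis by (simp add: euclidean_representation)
qed

lemma ck_on_cong:
  assumes "open S" "\<And>x. x \<in> S \<Longrightarrow> f x = g x" "ck_on r S f"
  shows "ck_on r S g"
  using assms(2,3)
proof (induction r arbitrary: f g)
  case 0
  then show ?case by (metis ck_on.simps(1) continuous_on_cong)
next
  case (Suc r)
  have der: "(g has_derivative frechet_derivative f (at x)) (at x)" if "x \<in> S" for x
    using Suc.prems that assms(1)
    by (metis ck_on.simps(2) frechet_derivative_works has_derivative_transform_within_open)
  have "frechet_derivative f (at x) v = frechet_derivative g (at x) v" if "x \<in> S" for x v
    using frechet_derivative_at[OF der[OF that]] by simp
  with Suc.IH Suc.prems(2) have "ck_on r S (\<lambda>x. frechet_derivative g (at x) v)" for v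
    by (metis (no_types, lifting) ck_on.simps(2))
  with der show ?case by (auto simp: differentiable_def)
qed

text \<open>
  The derivative in the definition of \<open>ck_on\<close> may be replaced by any expression that equals
  it on the open set. This is what makes proofs by induction on the order go through.
\<close>

lemma ck_on_SucI:
  assumes "open S" "\<And>x. x \<in> S \<Longrightarrow> (f has_derivative f' x) (at x)"
    and "\<And>v. ck_on r S (\<lambda>x. f' x v)"
  shows "ck_on (Suc r) S f"
proof -
  have "f' x v = frechet_derivative f (at x) v" if "x \<in> S" for x v
    using frechet_derivative_at[OF assms(2)[OF that]] by simp
  then have "ck_on r S (\<lambda>x. frechet_derivative f (at x) v)" for v
    by (rule ck_on_cong[OF assms(1) _ assms(3)])
  with assms(2) show ?thesis by (auto simp: differentiable_def)
qed

lemma ck_on_SucD: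
  assumes "ck_on (Suc r) S f"
  shows "x \<in> S \<Longrightarrow> (f has_derivative frechet_derivative f (at x)) (at x)"
    and "ck_on r S (\<lambda>x. frechet_derivative f (at x) v)"
  using assms frechet_derivative_works by auto

lemma ck_on_SucE: "ck_on (Suc r) S f \<Longrightarrow> ck_on r S f"
proof (induction r arbitrary: f)
  case 0
  then show ?case
    by (auto intro!: continuous_at_imp_continuous_on differentiable_imp_continuous_within)
next
  case (Suc r)
  have "ck_on r S (\<lambda>x. frechet_derivative f (at x) v)" for v
    by (rule Suc.IH[OF ck_on_SucD(2)[OF Suc.prems]])
  with Suc.prems show ?case by simp
qed

lemma ck_on_const: "ck_on r S (\<lambda>x. c)"
  by (induction r arbitrary: c) auto

lemma ck_on_bounded_linear:
  assumes "open S" "bounded_linear L" "ck_on r S f"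
  shows "ck_on r S (\<lambda>x. L (f x))"
  using assms(3)
proof (induction r arbitrary: f)
  case 0
  then show ?case using bounded_linear.continuous_on[OF assms(2)] by auto
next
  case (Suc r)
  show ?case
    by (rule ck_on_SucI[OF assms(1) bounded_linear.has_derivative[OF assms(2) ck_on_SucD(1)[OF Suc.prems]]])
      (assumption, intro Suc.IH ck_on_SucD(2)[OF Suc.prems])
qed

lemma ck_on_id: "open S \<Longrightarrow> ck_on r S (\<lambda>x. x)"
  by (cases r) (auto intro!: ck_on_SucI ck_on_const has_derivative_ident simp del: ck_on.simps(2))

lemma ck_on_add:
  assumes "open S" "ck_on r S f" "ck_on r S g"
  shows "ck_on r S (\<lambda>x. f x + g x)"
  using assms(2,3)
proof (induction r arbitrary: f g)
  case 0
  then show ?case by (auto intro: continuous_intros)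
next
  case (Suc r)
  show ?case
    by (rule ck_on_SucI[OF assms(1) has_derivative_add[OF
            ck_on_SucD(1)[OF Suc.prems(1)] ck_on_SucD(1)[OF Suc.prems(2)]]])
      (assumption+, intro Suc.IH ck_on_SucD(2)[OF Suc.prems(1)] ck_on_SucD(2)[OF Suc.prems(2)])
qed

lemma ck_on_sum:
  assumes "open S" "\<And>i. i \<in> I \<Longrightarrow> ck_on r S (f i)"
  shows "ck_on r S (\<lambda>x. \<Sum>i\<in>I. f i x)"
  using assms(2)
  by (induction I rule: infinite_finite_induct) (auto intro: ck_on_const ck_on_add assms(1))

lemma ck_on_scaleR:
  fixes h :: "'a::euclidean_space \<Rightarrow> real"
  assumes "open S" "ck_on r S h" "ck_on r S f"
  shows "ck_on r S (\<lambda>x. h x *\<^sub>R f x)"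
  using assms(2,3)
proof (induction r arbitrary: h f)
  case 0
  then show ?case by (auto intro: continuous_intros)
next
  case (Suc r)
  note D = ck_on_SucD[OF Suc.prems(1)] ck_on_SucD[OF Suc.prems(2)]
    and E = ck_on_SucE[OF Suc.prems(1)] ck_on_SucE[OF Suc.prems(2)]
  show ?case
    by (rule ck_on_SucI[OF assms(1) has_derivative_scaleR[OF D(1) D(3)]])
      (assumption+, intro ck_on_add assms(1) Suc.IH D E)
qed

text \<open>
  The chain rule writes the derivative as \<open>\<Sum>b. (Df v \<bullet> b) (D\<^sub>b h \<circ> f)\<close>, a sum of products of
  functions that are one order less differentiable, among them compositions covered by the
  induction hypothesis.
\<close>

lemma ck_on_compose:
  fixes f :: "'a::euclidean_space \<Rightarrow> 'b::euclidean_space"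
  assumes "open S" "open T" "\<And>x. x \<in> S \<Longrightarrow> f x \<in> T" "ck_on r S f" "ck_on r T h"
  shows "ck_on r S (\<lambda>x. h (f x))"
  using assms(4,5)
proof (induction r arbitrary: h)
  case 0
  then show ?case using assms(3) by (auto intro: continuous_on_compose2)
next
  case (Suc r)
  let ?D = "frechet_derivative"
  have lin: "linear (?D h (at (f x)))" if "x \<in> S" for x
    using ck_on_SucD(1)[OF Suc.prems(2) assms(3)[OF that]] has_derivative_linear by blast
  show ?case
  proof (rule ck_on_SucI[OF assms(1)])
    show "((\<lambda>x. h (f x)) has_derivative
      (\<lambda>v. \<Sum>b\<in>Basis. (?D f (at x) v \<bullet> b) *\<^sub>R ?D h (at (f x)) b)) (at x)" if x: "x \<in> S" for x
    proof -
      have "((\<lambda>x. h (f x)) has_derivative (\<lambda>v. ?D h (at (f x)) (?D f (at x) v))) (at x)"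
        using diff_chain_at[OF ck_on_SucD(1)[OF Suc.prems(1) x] ck_on_SucD(1)[OF Suc.prems(2) assms(3)[OF x]]]
        by (simp add: o_def)
      then show ?thesis by (subst (asm) linear_Basis_expansion[OF lin[OF x]])
    qed
    show "ck_on r S (\<lambda>x. \<Sum>b\<in>Basis. (?D f (at x) v \<bullet> b) *\<^sub>R ?D h (at (f x)) b)" for v
      by (intro ck_on_sum ck_on_scaleR assms(1) ck_on_bounded_linear[OF _ bounded_linear_inner_left]
          Suc.IH ck_on_SucE[OF Suc.prems(1)] ck_on_SucD(2)[OF Suc.prems(1)] ck_on_SucD(2)[OF Suc.prems(2)])
  qed
qed

lemma ck_on_inverse:
  fixes h :: "'a::euclidean_space \<Rightarrow> real"
  assumes "open S" "\<And>x. x \<in> S \<Longrightarrow> h x \<noteq> 0" "ck_on r S h"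
  shows "ck_on r S (\<lambda>x. inverse (h x))"
  using assms(3)
proof (induction r)
  case 0
  then show ?case using assms(2) by (auto intro!: continuous_intros)
next
  case (Suc r)
  then have IH: "ck_on r S (\<lambda>x. inverse (h x))" using ck_on_SucE by blast
  show ?case
  proof (rule ck_on_SucI[OF assms(1)])
    show "((\<lambda>x. inverse (h x)) has_derivative
       (\<lambda>v. (- 1 * inverse (h x)) *\<^sub>R (inverse (h x) *\<^sub>R frechet_derivative h (at x) v))) (at x)"
      if "x \<in> S" for x
      using Deriv.has_derivative_inverse[OF assms(2)[OF that] ck_on_SucD(1)[OF Suc.prems that]]
      by (simp add: mult_ac)
    show "ck_on r S (\<lambda>x. (- 1 * inverse (h x)) *\<^sub>R (inverse (h x) *\<^sub>R frechet_derivative h (at x) v))" for v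
      by (intro ck_on_scaleR assms(1) IH ck_on_SucD(2)[OF Suc.prems]
          ck_on_bounded_linear[OF assms(1) bounded_linear_mult_right])
  qed
qed

lemma smooth_onD:
  assumes "smooth_on S f"
  shows "x \<in> S \<Longrightarrow> (f has_derivative frechet_derivative f (at x)) (at x)"
    and "continuous_on S f"
    and "smooth_on S (\<lambda>x. frechet_derivative f (at x) v)"
proof -
  show "(f has_derivative frechet_derivative f (at x)) (at x)" if "x \<in> S"
    using assms that ck_on_SucD(1)[of 0 S f] by (simp add: smooth_on_def del: ck_on.simps)
  show "continuous_on S f" using assms ck_on.simps(1) unfolding smooth_on_def by blast
  show "smooth_on S (\<lambda>x. frechet_derivative f (at x) v)"
    using assms ck_on_SucD(2) unfolding smooth_on_def by blast
qed

lemma smooth_on_subset: "smooth_on S f \<Longrightarrow> T \<subseteq> S \<Longrightarrow> smooth_on T f"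
proof -
  have "ck_on r S f \<Longrightarrow> T \<subseteq> S \<Longrightarrow> ck_on r T f" for r
    by (induction r arbitrary: f) (auto intro: continuous_on_subset)
  then show "smooth_on S f \<Longrightarrow> T \<subseteq> S \<Longrightarrow> smooth_on T f"
    by (simp add: smooth_on_def)
qed

lemma smooth_on_cong:
  assumes "open S" "\<And>x. x \<in> S \<Longrightarrow> f x = g x" "smooth_on S f"
  shows "smooth_on S g"
  using assms(3) ck_on_cong[OF assms(1,2)] unfolding smooth_on_def by simp

lemma smooth_on_const: "smooth_on S (\<lambda>x. c)"
  by (simp add: smooth_on_def ck_on_const)

lemma smooth_on_bounded_linear:
  "open S \<Longrightarrow> bounded_linear L \<Longrightarrow> smooth_on S f \<Longrightarrow> smooth_on S (\<lambda>x. L (f x))"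
  by (simp add: smooth_on_def ck_on_bounded_linear)

lemma smooth_on_linear:
  assumes "open S" "bounded_linear L" shows "smooth_on S L"
  using ck_on_bounded_linear[OF assms ck_on_id[OF assms(1)]] by (simp add: smooth_on_def)

lemma smooth_on_add:
  "open S \<Longrightarrow> smooth_on S f \<Longrightarrow> smooth_on S g \<Longrightarrow> smooth_on S (\<lambda>x. f x + g x)"
  by (simp add: smooth_on_def ck_on_add)

lemma smooth_on_sum:
  "open S \<Longrightarrow> (\<And>i. i \<in> I \<Longrightarrow> smooth_on S (f i)) \<Longrightarrow> smooth_on S (\<lambda>x. \<Sum>i\<in>I. f i x)"
  by (simp add: smooth_on_def ck_on_sum)

lemma smooth_on_scaleR:
  fixes h :: "'a::euclidean_space \<Rightarrow> real"
  shows "open S \<Longrightarrow> smooth_on S h \<Longrightarrow> smooth_on S f \<Longrightarrow> smooth_on S (\<lambda>x. h x *\<^sub>R f x)"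
  by (simp add: smooth_on_def ck_on_scaleR)

lemma smooth_on_compose:
  fixes f :: "'a::euclidean_space \<Rightarrow> 'b::euclidean_space"
  shows "open S \<Longrightarrow> open T \<Longrightarrow> (\<And>x. x \<in> S \<Longrightarrow> f x \<in> T) \<Longrightarrow> smooth_on S f \<Longrightarrow> smooth_on T h \<Longrightarrow>
    smooth_on S (\<lambda>x. h (f x))"
  by (simp add: smooth_on_def ck_on_compose)

lemma smooth_on_inverse:
  fixes h :: "'a::euclidean_space \<Rightarrow> real"
  shows "open S \<Longrightarrow> (\<And>x. x \<in> S \<Longrightarrow> h x \<noteq> 0) \<Longrightarrow> smooth_on S h \<Longrightarrow> smooth_on S (\<lambda>x. inverse (h x))"
  by (simp add: smooth_on_def ck_on_inverse)

lemma smooth_on_componentwise: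
  fixes f :: "'a::euclidean_space \<Rightarrow> 'b::euclidean_space"
  assumes "open S" "\<And>b. b \<in> Basis \<Longrightarrow> smooth_on S (\<lambda>x. f x \<bullet> b)"
  shows "smooth_on S f"
proof -
  have "smooth_on S (\<lambda>x. \<Sum>b\<in>Basis. (f x \<bullet> b) *\<^sub>R b)"
    by (intro smooth_on_sum smooth_on_scaleR assms smooth_on_const)
  then show ?thesis by (simp add: euclidean_representation)
qed

lemma smooth_on_Pair:
  fixes f :: "'a::euclidean_space \<Rightarrow> 'b::euclidean_space" and g :: "'a \<Rightarrow> 'c::euclidean_space"
  assumes "open S" "smooth_on S f" "smooth_on S g"
  shows "smooth_on S (\<lambda>x. (f x, g x))"
proof -
  have "smooth_on S (\<lambda>x. (f x, 0) + (0, g x))"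
    by (intro smooth_on_add assms smooth_on_bounded_linear[OF assms(1), where L="\<lambda>y. (y, 0)"]
     smooth_on_bounded_linear[OF assms(1), where L="\<lambda>y. (0, y)"])
     (auto intro!: bounded_linear_Pair bounded_linear_ident bounded_linear_zero)
  then show ?thesis by simp
qed

section \<open>The inverse function theorem for smooth maps\<close>

text \<open>
  Injectivity of a continuous family of linear maps is an open condition, with a uniform
  lower bound; the bound is what gives continuity of the inverse family.
\<close>

lemma linear_family_bounded_below:
  fixes T :: "'a::topological_space \<Rightarrow> 'b::euclidean_space \<Rightarrow> 'c::euclidean_space"
  assumes "open S" "x\<^sub>0 \<in> S" "\<And>x. x \<in> S \<Longrightarrow> linear (T x)" "inj (T x\<^sub>0)"
    and cont: "\<And>b. continuous_on S (\<lambda>x. T x b)"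
  obtains B U where "B > 0" "open U" "x\<^sub>0 \<in> U" "U \<subseteq> S" "\<And>x b. x \<in> U \<Longrightarrow> B * norm b \<le> norm (T x b)"
proof -
  obtain B where B: "B > 0" "\<And>b. B * norm b \<le> norm (T x\<^sub>0 b)"
    using linear_inj_bounded_below_pos assms by blast
  define e where "e x = (\<Sum>i\<in>Basis. norm (T x i - T x\<^sub>0 i))" for x
  have cont_e: "continuous_on S e"
    unfolding e_def by (intro continuous_intros cont)
  define U where "U = {x \<in> S. e x < B / 2}"
  have "U = S \<inter> e -` {..<B / 2}" by (auto simp: U_def)
  then have "open U"
    using cont_e assms(1) by (metis continuous_on_open_vimage open_lessThan Int_commute)
  moreover have "x\<^sub>0 \<in> U" using B assms by (simp add: U_def e_def)
  moreover have "B / 2 * norm b \<le> norm (T x b)" if "x \<in> U" for x b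
  proof -
    have x: "x \<in> S" "e x < B / 2" using that by (auto simp: U_def)
    have "T x b - T x\<^sub>0 b = (\<Sum>i\<in>Basis. (b \<bullet> i) *\<^sub>R (T x i - T x\<^sub>0 i))"
      by (simp add: linear_Basis_expansion[OF assms(3)[OF x(1)], of b]
          linear_Basis_expansion[OF assms(3)[OF assms(2)], of b] scaleR_diff_right sum_subtractf)
    also have "norm \<dots> \<le> (\<Sum>i\<in>Basis. norm b * norm (T x i - T x\<^sub>0 i))"
      by (rule sum_norm_le) (simp add: Basis_le_norm mult_right_mono)
    also have "\<dots> \<le> B / 2 * norm b"
      using x(2) mult_left_mono[of "e x" "B / 2" "norm b"]
      by (simp add: e_def mult.commute flip: sum_distrib_left)
    finally have "norm (T x b - T x\<^sub>0 b) \<le> B / 2 * norm b" .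
    moreover have "norm (T x\<^sub>0 b) \<le> norm (T x b) + norm (T x b - T x\<^sub>0 b)"
      by (metis norm_minus_commute norm_triangle_sub)
    ultimately show ?thesis using B(2)[of b] by simp
  qed
  ultimately show ?thesis using that[of "B/2" U] B by (auto simp: U_def)
qed

text \<open>
  A product rule in which one factor is merely continuous: the other factor vanishes at the
  point and absorbs the missing differentiability.
\<close>

lemma has_derivative_scaleR_zero:
  fixes \<phi> :: "'a::real_normed_vector \<Rightarrow> real" and r :: "'a \<Rightarrow> 'b::real_normed_vector"
  assumes "(\<phi> has_derivative \<phi>') (at x)" "\<phi> x = 0" "isCont r x"
  shows "((\<lambda>y. \<phi> y *\<^sub>R r y) has_derivative (\<lambda>v. \<phi>' v *\<^sub>R r x)) (at x)"
proof -
  have bl: "bounded_linear \<phi>'" using assms(1) has_derivative_bounded_linear by blast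
  obtain K where K: "\<And>v. \<bar>\<phi>' v\<bar> \<le> norm v * K" "K > 0"
    using bounded_linear.pos_bounded[OF bl] by auto
  have "((\<lambda>y. \<phi> y *\<^sub>R r x) has_derivative (\<lambda>v. \<phi>' v *\<^sub>R r x)) (at x)"
    using assms(1) by (auto intro!: derivative_eq_intros)
  moreover have "((\<lambda>y. \<phi> y *\<^sub>R (r y - r x)) has_derivative (\<lambda>v. 0)) (at x)"
    unfolding has_derivative_at_alt
  proof (intro conjI allI impI)
    show "bounded_linear (\<lambda>v::'a. 0::'b)" by simp
    fix e :: real assume "e > 0"
    obtain d1 where d1: "d1 > 0" "\<And>y. norm (y - x) < d1 \<Longrightarrow>
        norm (\<phi> y - \<phi> x - \<phi>' (y - x)) \<le> 1 * norm (y - x)"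
      using assms(1) zero_less_one unfolding has_derivative_at_alt by blast
    obtain d2 where d2: "d2 > 0" "\<And>y. dist y x < d2 \<Longrightarrow> dist (r y) (r x) < e / (1 + K)"
      using assms(3) \<open>e > 0\<close> \<open>K > 0\<close> unfolding continuous_at_eps_delta
      by (metis add_pos_pos divide_pos_pos zero_less_one)
    show "\<exists>d>0. \<forall>y. norm (y - x) < d \<longrightarrow>
       norm (\<phi> y *\<^sub>R (r y - r x) - \<phi> x *\<^sub>R (r x - r x) - 0) \<le> e * norm (y - x)"
    proof (intro exI[of _ "min d1 d2"] conjI allI impI)
      fix y assume y: "norm (y - x) < min d1 d2"
      have "\<bar>\<phi> y\<bar> \<le> (1 + K) * norm (y - x)"
        using d1(2)[of y] K(1)[of "y - x"] y assms(2) by (simp add: algebra_simps abs_le_iff)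
      moreover have "norm (r y - r x) \<le> e / (1 + K)"
        using d2(2)[of y] y by (simp add: dist_norm)
      ultimately have "\<bar>\<phi> y\<bar> * norm (r y - r x) \<le> ((1 + K) * norm (y - x)) * (e / (1 + K))"
        using K(2) by (intro mult_mono) auto
      also have "\<dots> = e * norm (y - x)" using K(2) by (simp add: field_simps)
      finally show "norm (\<phi> y *\<^sub>R (r y - r x) - \<phi> x *\<^sub>R (r x - r x) - 0) \<le> e * norm (y - x)" by simp
    qed (use d1 d2 in auto)
  qed
  ultimately have "((\<lambda>y. \<phi> y *\<^sub>R r x + \<phi> y *\<^sub>R (r y - r x)) has_derivative (\<lambda>v. \<phi>' v *\<^sub>R r x + 0)) (at x)"
    by (rule has_derivative_add)
  then show ?thesis by (simp add: algebra_simps)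
qed

text \<open>
  For \<open>R = T\<^sup>-\<^sup>1\<close> one has \<open>R x - R y = - R x (T x - T y) (R y)\<close>. Together with the uniform lower bound
  this gives continuity of \<open>R\<close>, then differentiability with derivative \<open>- R (DT) R\<close>, and
  the latter formula raises the order of differentiability by one in each step of an induction.
\<close>

lemma smooth_on_inverse_family:
  fixes T :: "'a::euclidean_space \<Rightarrow> 'b::euclidean_space \<Rightarrow> 'c::euclidean_space"
  assumes S: "open S" and lin: "\<And>x. x \<in> S \<Longrightarrow> linear (T x)" and linR: "\<And>x. x \<in> S \<Longrightarrow> linear (R x)"
    and RT: "\<And>x b. x \<in> S \<Longrightarrow> R x (T x b) = b" and TR: "\<And>x c. x \<in> S \<Longrightarrow> T x (R x c) = c"
    and smooth: "\<And>b. smooth_on S (\<lambda>x. T x b)"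
  shows "smooth_on S (\<lambda>x. R x c)"
proof -
  have contT: "continuous_on S (\<lambda>x. T x b)" for b
    using smooth smooth_onD(2) by blast
  have diff: "R x c - R y c = - R x (T x (R y c) - T y (R y c))" if "x \<in> S" "y \<in> S" for x y c
    using that by (simp add: RT TR linear_diff[OF linR])
  have contR: "isCont (\<lambda>x. R x c) y" if y: "y \<in> S" for y c
  proof -
    have "inj (T y)" using RT[OF y] by (metis injI)
    then obtain B U where B: "B > 0" "open U" "y \<in> U" "U \<subseteq> S"
        "\<And>x b. x \<in> U \<Longrightarrow> B * norm b \<le> norm (T x b)"
      using linear_family_bounded_below[OF S y lin _ contT] by blast
    have bound: "norm (R x v) \<le> (1 / B) * norm v" if "x \<in> U" for x v
      using B(5)[OF that, of "R x v"] TR[of x v] that B(1,4) by (auto simp: field_simps)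
    have "((\<lambda>x. T x (R y c) - T y (R y c)) \<longlongrightarrow> 0) (at y)"
      using contT[of "R y c"] y S by (metis LIM_zero continuous_on_eq_continuous_at isCont_def)
    then have "((\<lambda>x. (1 / B) * norm (T x (R y c) - T y (R y c))) \<longlongrightarrow> 0) (at y)"
      using tendsto_mult_right_zero[OF tendsto_norm_zero] by blast
    moreover have "eventually (\<lambda>x. norm (R x c - R y c) \<le> (1 / B) * norm (T x (R y c) - T y (R y c))) (at y)"
    proof (rule eventually_at_in_open'[OF B(2,3), THEN eventually_mono])
      fix x assume "x \<in> U"
      then show "norm (R x c - R y c) \<le> (1 / B) * norm (T x (R y c) - T y (R y c))"
        using bound diff[OF _ y, of x c] B(4) by fastforce
    qed
    ultimately have "((\<lambda>x. R x c - R y c) \<longlongrightarrow> 0) (at y)"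
      by (rule Lim_null_comparison[rotated])
    then show ?thesis using isCont_def LIM_zero_iff by blast
  qed
  let ?D = "frechet_derivative"
  define R' where "R' c x v = - (\<Sum>i\<in>Basis. ((\<Sum>j\<in>Basis. (R x c \<bullet> j) *\<^sub>R ?D (\<lambda>x. T x j) (at x) v) \<bullet> i) *\<^sub>R R x i)"
    for c x v
  have derR: "((\<lambda>x. R x c) has_derivative R' c y) (at y)" if y: "y \<in> S" for y c
  proof -
    have TRy: "((\<lambda>x. T x (R y c)) has_derivative (\<lambda>v. \<Sum>j\<in>Basis. (R y c \<bullet> j) *\<^sub>R ?D (\<lambda>x. T x j) (at y) v)) (at y)"
    proof (rule has_derivative_transform_within_open[OF _ S y])
      show "((\<lambda>x. \<Sum>j\<in>Basis. (R y c \<bullet> j) *\<^sub>R T x j) has_derivative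
         (\<lambda>v. \<Sum>j\<in>Basis. (R y c \<bullet> j) *\<^sub>R ?D (\<lambda>x. T x j) (at y) v)) (at y)"
        by (intro has_derivative_sum has_derivative_scaleR_right smooth_onD(1)[OF smooth y])
    qed (simp add: linear_Basis_expansion[OF lin, symmetric])
    have "((\<lambda>x. \<Sum>i\<in>Basis. ((T x (R y c) - T y (R y c)) \<bullet> i) *\<^sub>R R x i) has_derivative
       (\<lambda>v. \<Sum>i\<in>Basis. ((\<Sum>j\<in>Basis. (R y c \<bullet> j) *\<^sub>R ?D (\<lambda>x. T x j) (at y) v) \<bullet> i) *\<^sub>R R y i)) (at y)"
      by (intro has_derivative_sum has_derivative_scaleR_zero contR y)
        (auto intro!: derivative_eq_intros TRy)
    then have "((\<lambda>x. R y c - (\<Sum>i\<in>Basis. ((T x (R y c) - T y (R y c)) \<bullet> i) *\<^sub>R R x i)) has_derivative R' c y) (at y)"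
      by (rule has_derivative_diff[OF has_derivative_const, THEN has_derivative_eq_rhs])
        (simp add: R'_def fun_eq_iff)
    then show ?thesis
    proof (rule has_derivative_transform_within_open[OF _ S y])
      fix x assume x: "x \<in> S"
      show "R y c - (\<Sum>i\<in>Basis. ((T x (R y c) - T y (R y c)) \<bullet> i) *\<^sub>R R x i) = R x c"
        unfolding linear_Basis_expansion[OF linR[OF x], of "T x (R y c) - T y (R y c)", symmetric]
        using diff[OF x y, of c] by (simp add: diff_eq_eq)
    qed
  qed
  have "ck_on r S (\<lambda>x. R x c)" for r c
  proof (induction r arbitrary: c)
    case 0
    then show ?case using contR by (auto intro: continuous_at_imp_continuous_on)
  next
    case (Suc r)
    have "ck_on r S (\<lambda>x. ?D (\<lambda>x. T x j) (at x) v)" for j v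
      using smooth_onD(3)[OF smooth] by (simp add: smooth_on_def)
    then show ?case
      unfolding R'_def
      by (intro ck_on_SucI[OF S derR] ) (auto simp: R'_def intro!: ck_on_sum ck_on_scaleR S Suc.IH
          ck_on_bounded_linear[OF S bounded_linear_inner_left]
          ck_on_bounded_linear[OF S bounded_linear_minus[OF bounded_linear_ident]])
  qed
  then show ?thesis by (simp add: smooth_on_def)
qed

text \<open>
  Composing with the inverse of the derivative at the base point reduces the case of two
  different spaces of the same dimension to that of a self-map. The derivative of
  the local inverse \<open>h\<close> is \<open>R \<circ> h\<close>, with \<open>R\<close> the family of inverse derivatives; \<open>R\<close> is smooth, so
  \<open>h\<close> is smooth by induction on the order.
\<close>

theorem smooth_inverse_function_theorem:
  fixes f :: "'a::euclidean_space \<Rightarrow> 'b::euclidean_space"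
  assumes S: "open S" "x\<^sub>0 \<in> S" and f: "smooth_on S f"
    and dim: "DIM('a) = DIM('b)" and inj: "inj (frechet_derivative f (at x\<^sub>0))"
  obtains U V g where "open U" "x\<^sub>0 \<in> U" "U \<subseteq> S" "open V" "homeomorphism U V f g" "smooth_on V g"
    "\<And>x. x \<in> U \<Longrightarrow> bij (frechet_derivative f (at x))"
proof -
  let ?D = "\<lambda>x. frechet_derivative f (at x)"
  have linD: "linear (?D x)" if "x \<in> S" for x
    using smooth_onD(1)[OF f that] has_derivative_linear by blast
  have surj: "surj (?D x\<^sub>0)"
    using linear_injective_imp_surjective[OF linD[OF S(2)] inj] dim by simp
  obtain M where M: "linear M" "\<And>v. M (?D x\<^sub>0 v) = v"
    using linear_injective_left_inverse[OF linD[OF S(2)] inj] by (metis comp_apply id_apply)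
  have M': "?D x\<^sub>0 (M w) = w" for w
    using surj M(2) by (metis surjE)
  have bijM: "bij M" using M(2) M' by (metis bij_iff)
  have blM: "bounded_linear M" using M(1) linear_conv_bounded_linear by blast
  define F where "F x = Blinfun (\<lambda>v. M (?D x v))" for x
  have F: "blinfun_apply (F x) = (\<lambda>v. M (?D x v))" if "x \<in> S" for x
    unfolding F_def
    by (rule bounded_linear_Blinfun_apply)
      (use linD[OF that] blM linear_conv_bounded_linear bounded_linear_compose in blast)
  have "\<And>x. x \<in> S \<Longrightarrow> ((\<lambda>x. M (f x)) has_derivative blinfun_apply (F x)) (at x)"
    using bounded_linear.has_derivative[OF blM smooth_onD(1)[OF f]] F by simp
  moreover have "continuous_on S F"
  proof (rule continuous_on_blinfun_componentwise)
    fix i :: 'a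
    have "continuous_on S (\<lambda>x. M (?D x i))"
      by (rule bounded_linear.continuous_on[OF blM smooth_onD(2)[OF smooth_onD(3)[OF f]]])
    then show "continuous_on S (\<lambda>x. blinfun_apply (F x) i)"
      using F by (metis (no_types, lifting) continuous_on_cong)
  qed
  moreover have "id_blinfun o\<^sub>L F x\<^sub>0 = id_blinfun"
    by (rule blinfun_eqI) (simp add: F[OF S(2)] M)
  ultimately obtain U V g g' where UV: "open U" "U \<subseteq> S" "x\<^sub>0 \<in> U" "open V"
      and hom: "homeomorphism U V (\<lambda>x. M (f x)) g"
      and dg: "\<And>y. y \<in> V \<Longrightarrow> (g has_derivative g' y) (at y)"
      "\<And>y. y \<in> V \<Longrightarrow> g' y = inv (blinfun_apply (F (g y)))"
      and bij: "\<And>y. y \<in> V \<Longrightarrow> bij (blinfun_apply (F (g y)))"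
    using inverse_function_theorem[OF S(1) _ _ S(2)] by metis
  define V' where "V' = M -` V"
  define h where "h w = g (M w)" for w
  have oV': "open V'"
    unfolding V'_def using UV(4) bounded_linear.continuous_on[OF blM continuous_on_id]
    by (rule open_vimage)
  have gV: "g y \<in> U" if "y \<in> V" for y using hom that by (auto simp: homeomorphism_def)
  have fU: "f x \<in> V'" if "x \<in> U" for x using hom that by (auto simp: homeomorphism_def V'_def)
  have hf: "h (f x) = x" if "x \<in> U" for x using hom that by (auto simp: homeomorphism_def h_def)
  have fh: "f (h w) = w" if "w \<in> V'" for w
  proof -
    have "M (f (g (M w))) = M w" using hom that by (auto simp: homeomorphism_def V'_def)
    then show ?thesis using bijM by (simp add: h_def bij_is_inj inj_eq)
  qed
  have hV: "h w \<in> U" if "w \<in> V'" for w using gV that by (auto simp: V'_def h_def)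
  have bijD: "bij (?D x)" if "x \<in> U" for x
  proof -
    have x: "x \<in> S" using that UV by blast
    have "M (f x) \<in> V" "g (M (f x)) = x" using hom that by (auto simp: homeomorphism_def)
    then have "bij (\<lambda>v. M (?D x v))" using bij[of "M (f x)"] F[OF x] by simp
    then have "inj (?D x)" by (metis (mono_tags, lifting) bij_is_inj injD injI)
    moreover have "surj (?D x)"
      using linear_injective_imp_surjective[OF linD[OF x] calculation] dim by simp
    ultimately show ?thesis by (simp add: bij_def)
  qed
  define R where "R x = inv (?D x)" for x
  have linR: "linear (R x)" if "x \<in> U" for x
  proof -
    have "linear (?D x)" "inj (?D x)" using linD bijD that UV(2) by (auto simp: bij_is_inj)
    then obtain N where N: "linear N" "N \<circ> ?D x = id"
      using linear_injective_left_inverse by blast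
    have "R x w = N w" for w
      using bijD[OF that] N(2) by (metis R_def bij_is_surj surj_f_inv_f comp_apply id_apply)
    then show ?thesis using N(1) by presburger
  qed
  have smR: "smooth_on U (\<lambda>x. R x c)" for c
  proof (rule smooth_on_inverse_family[OF UV(1)])
    fix x b d assume x: "x \<in> U"
    show "R x (?D x b) = b" using bijD[OF x] by (simp add: R_def bij_is_inj)
    show "?D x (R x d) = d" using bijD[OF x] by (simp add: R_def bij_is_surj surj_f_inv_f)
    show "linear (R x)" by (rule linR[OF x])
    show "linear (?D x)" using linD x UV(2) by blast
  next
    show "smooth_on U (\<lambda>x. ?D x b)" for b
      by (rule smooth_on_subset[OF smooth_onD(3)[OF f] UV(2)])
  qed
  \<comment> \<open>The theorem for self-maps provides the derivative of \<open>g\<close> as the inverse of \<open>M \<circ> Df\<close>; composing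
    with \<open>M\<close> cancels this factor.\<close>
  have dh: "(h has_derivative R (h w)) (at w)" if w: "w \<in> V'" for w
  proof -
    have Mw: "M w \<in> V" and hS: "h w \<in> S" using w hV UV(2) by (auto simp: V'_def)
    have "(h has_derivative (\<lambda>v. g' (M w) (M v))) (at w)"
      unfolding h_def
      using diff_chain_at[OF bounded_linear.has_derivative[OF blM has_derivative_ident] dg(1)[OF Mw]]
      by (simp add: o_def)
    have "g' (M w) (M v) = R (h w) v" for v
    proof -
      have "g' (M w) = inv (\<lambda>v. M (?D (h w) v))"
        using dg(2)[OF Mw] F[OF hS] by (simp add: h_def)
      moreover have "inv (\<lambda>v. M (?D (h w) v)) (M v) = R (h w) v"
      proof (rule inv_f_eq)
        show "inj (\<lambda>v. M (?D (h w) v))"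
          using bij[OF Mw] F[OF hS] by (simp add: h_def bij_is_inj)
        show "M (?D (h w) (R (h w) v)) = M v"
          using bijD[OF hV[OF w]] by (simp add: R_def bij_is_surj surj_f_inv_f)
      qed
      ultimately show ?thesis by simp
    qed
    then have "(\<lambda>v. g' (M w) (M v)) = R (h w)" by blast
    with \<open>(h has_derivative (\<lambda>v. g' (M w) (M v))) (at w)\<close> show ?thesis by metis
  qed
  have ckh: "ck_on r V' h" for r
  proof (induction r)
    case 0
    then show ?case using dh
      by (auto intro!: continuous_at_imp_continuous_on has_derivative_continuous)
  next
    case (Suc r)
    show ?case
      by (rule ck_on_SucI[OF oV' dh])
        (use smR in \<open>auto simp: smooth_on_def intro!: ck_on_compose[OF oV' UV(1) hV Suc]\<close>)
  qed
  have "homeomorphism U V' f h"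
  proof (rule homeomorphismI)
    show "continuous_on U f" using smooth_onD(2)[OF smooth_on_subset[OF f UV(2)]] .
    show "continuous_on V' h" using ckh[of 0] by simp
  qed (use fU hV hf fh in auto)
  then show ?thesis using that UV oV' ckh bijD by (auto simp: smooth_on_def)
qed

section \<open>Symmetry of second derivatives and Lie brackets\<close>

lemma has_vector_derivative_compose:
  assumes "(\<gamma> has_vector_derivative w) (at t)" "(h has_derivative h') (at (\<gamma> t))"
  shows "((\<lambda>t. h (\<gamma> t)) has_vector_derivative h' w) (at t)"
  using vector_derivative_diff_chain_within[OF assms(1) has_derivative_at_withinI[OF assms(2)]]
  by (simp add: o_def)

lemma has_real_derivative_along_line:
  fixes f :: "'a::real_normed_vector \<Rightarrow> real"
  assumes "(f has_derivative f') (at (p + s *\<^sub>R a))"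
  shows "((\<lambda>s. f (p + s *\<^sub>R a)) has_real_derivative f' a) (at s)"
  unfolding has_real_derivative_iff_has_vector_derivative
  by (rule has_vector_derivative_compose[where \<gamma>="\<lambda>s. p + s *\<^sub>R a", OF _ assms]) (auto intro!: derivative_eq_intros)

text \<open>
  The mean value theorem is applied first in the direction \<open>a\<close> and then in the direction \<open>b\<close>.
  The left-hand side is symmetric in the two directions, which is the reason for the symmetry of
  second derivatives.
\<close>

lemma second_difference_quotient:
  fixes f :: "'a::euclidean_space \<Rightarrow> real"
  assumes "smooth_on S f" "h > 0"
    and S: "\<And>s t. 0 \<le> s \<Longrightarrow> s \<le> h \<Longrightarrow> 0 \<le> t \<Longrightarrow> t \<le> h \<Longrightarrow> x + s *\<^sub>R a + t *\<^sub>R b \<in> S"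
  shows "\<exists>s t. 0 < s \<and> s < h \<and> 0 < t \<and> t < h \<and>
    f (x + h *\<^sub>R a + h *\<^sub>R b) - f (x + h *\<^sub>R a) - f (x + h *\<^sub>R b) + f x =
    h * h * frechet_derivative (\<lambda>y. frechet_derivative f (at y) a) (at (x + s *\<^sub>R a + t *\<^sub>R b)) b"
proof -
  let ?D = "\<lambda>y. frechet_derivative f (at y) a"
  let ?DD = "\<lambda>y. frechet_derivative ?D (at y) b"
  have 1: "((\<lambda>s. f (x + s *\<^sub>R a + t *\<^sub>R b)) has_real_derivative ?D (x + s *\<^sub>R a + t *\<^sub>R b)) (at s)"
    if "0 \<le> s" "s \<le> h" "0 \<le> t" "t \<le> h" for s t
    using has_real_derivative_along_line[OF smooth_onD(1)[OF assms(1)], of "x + t *\<^sub>R b" s a] S[OF that]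
    by (simp add: add_ac)
  have 2: "((\<lambda>t. ?D (x + s *\<^sub>R a + t *\<^sub>R b)) has_real_derivative ?DD (x + s *\<^sub>R a + t *\<^sub>R b)) (at t)"
    if "0 \<le> s" "s \<le> h" "0 \<le> t" "t \<le> h" for s t
    using has_real_derivative_along_line[OF smooth_onD(1)[OF smooth_onD(3)[OF assms(1)]], of "x + s *\<^sub>R a" t b] S[OF that]
    by simp
  have "\<exists>s>0. s < h \<and> (f (x + h *\<^sub>R a + h *\<^sub>R b) - f (x + h *\<^sub>R a)) - (f (x + 0 *\<^sub>R a + h *\<^sub>R b) - f (x + 0 *\<^sub>R a))
      = (h - 0) * (?D (x + s *\<^sub>R a + h *\<^sub>R b) - ?D (x + s *\<^sub>R a))"
    using 1[of _ h] 1[of _ 0] assms(2)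
    by (intro MVT2[OF assms(2)] DERIV_diff) auto
  then obtain s where s: "0 < s" "s < h" "f (x + h *\<^sub>R a + h *\<^sub>R b) - f (x + h *\<^sub>R a) - f (x + h *\<^sub>R b) + f x
      = h * (?D (x + s *\<^sub>R a + h *\<^sub>R b) - ?D (x + s *\<^sub>R a))" by auto
  have "\<exists>t>0. t < h \<and> ?D (x + s *\<^sub>R a + h *\<^sub>R b) - ?D (x + s *\<^sub>R a + 0 *\<^sub>R b)
      = (h - 0) * ?DD (x + s *\<^sub>R a + t *\<^sub>R b)"
    using 2[of s] s assms(2) by (intro MVT2[OF assms(2)]) auto
  then show ?thesis using s by auto
qed

lemma symmetric_second_derivative_real:
  fixes f :: "'a::euclidean_space \<Rightarrow> real"
  assumes "open S" "x \<in> S" "smooth_on S f"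
  shows "frechet_derivative (\<lambda>y. frechet_derivative f (at y) a) (at x) b
       = frechet_derivative (\<lambda>y. frechet_derivative f (at y) b) (at x) a" (is "?A x = ?B x")
proof (rule ccontr)
  assume "?A x \<noteq> ?B x"
  define e where "e = \<bar>?A x - ?B x\<bar> / 2"
  have "e > 0" using \<open>?A x \<noteq> ?B x\<close> by (simp add: e_def)
  have "isCont ?A x" "isCont ?B x"
    using smooth_onD(2)[OF smooth_onD(3)[OF smooth_onD(3)[OF assms(3)]]] assms
    by (simp_all add: continuous_on_eq_continuous_at)
  then obtain d1 d2 where d: "d1 > 0" "\<And>y. dist y x < d1 \<Longrightarrow> dist (?A y) (?A x) < e"
    "d2 > 0" "\<And>y. dist y x < d2 \<Longrightarrow> dist (?B y) (?B x) < e"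
    using \<open>e > 0\<close> unfolding continuous_at_eps_delta by metis
  obtain d3 where d3: "d3 > 0" "ball x d3 \<subseteq> S" using assms open_contains_ball by blast
  define d where "d = min d1 (min d2 d3)"
  \<comment> \<open>For this step size all points of the parallelogram stay within distance \<open>d\<close> of \<open>x\<close>.\<close>
  define h where "h = d / (2 * (1 + norm a + norm b))"
  have "d > 0" using d d3 by (simp add: d_def)
  have h: "h > 0" unfolding h_def using \<open>d > 0\<close> by (intro divide_pos_pos) (auto simp: add_pos_nonneg)
  have near: "dist (x + s *\<^sub>R a + t *\<^sub>R b) x < d" if "0 \<le> s" "s \<le> h" "0 \<le> t" "t \<le> h" for s t
  proof -
    have "dist (x + s *\<^sub>R a + t *\<^sub>R b) x = norm (s *\<^sub>R a + t *\<^sub>R b)" by (simp add: dist_norm add_ac)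
    also have "\<dots> \<le> s * norm a + t * norm b"
      using norm_triangle_ineq[of "s *\<^sub>R a" "t *\<^sub>R b"] that by simp
    also have "\<dots> \<le> h * norm a + h * norm b" using that by (intro add_mono mult_right_mono) auto
    also have "\<dots> < h * (2 * (1 + norm a + norm b))"
      using h by (simp add: algebra_simps add_nonneg_pos)
    also have "\<dots> = d" unfolding h_def by (simp add: add_pos_nonneg less_imp_neq[THEN not_sym] add_nonneg_pos)
    finally show ?thesis .
  qed
  have inS: "x + s *\<^sub>R a + t *\<^sub>R b \<in> S" if "0 \<le> s" "s \<le> h" "0 \<le> t" "t \<le> h" for s t
    using near[OF that] d3 by (auto simp: d_def dist_commute)
  have inS': "x + t *\<^sub>R b + s *\<^sub>R a \<in> S" if "0 \<le> t" "t \<le> h" "0 \<le> s" "s \<le> h" for s t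
    using inS[OF that(3,4,1,2)] by (simp add: add_ac)
  \<comment> \<open>The same second difference is evaluated in both orders; by continuity, each value is
    \<open>e\<close>-close to the corresponding second derivative at \<open>x\<close>.\<close>
  obtain s t where st: "0 < s" "s < h" "0 < t" "t < h"
    "f (x + h *\<^sub>R a + h *\<^sub>R b) - f (x + h *\<^sub>R a) - f (x + h *\<^sub>R b) + f x = h * h * ?A (x + s *\<^sub>R a + t *\<^sub>R b)"
    using second_difference_quotient[OF assms(3) h inS] by blast
  obtain s' t' where st': "0 < s'" "s' < h" "0 < t'" "t' < h"
    "f (x + h *\<^sub>R b + h *\<^sub>R a) - f (x + h *\<^sub>R b) - f (x + h *\<^sub>R a) + f x = h * h * ?B (x + t' *\<^sub>R b + s' *\<^sub>R a)"
    using second_difference_quotient[OF assms(3) h inS'] by blast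
  have "h * h * ?A (x + s *\<^sub>R a + t *\<^sub>R b) = h * h * ?B (x + s' *\<^sub>R a + t' *\<^sub>R b)"
    using st(5) st'(5) unfolding add.assoc add.commute[of "h *\<^sub>R b"] add.commute[of "t' *\<^sub>R b"]
    by linarith
  then have eq: "?A (x + s *\<^sub>R a + t *\<^sub>R b) = ?B (x + s' *\<^sub>R a + t' *\<^sub>R b)" using h by simp
  have "dist (?A (x + s *\<^sub>R a + t *\<^sub>R b)) (?A x) < e" using d(2) near[of s t] st by (simp add: d_def)
  moreover have "dist (?B (x + s' *\<^sub>R a + t' *\<^sub>R b)) (?B x) < e" using d(4) near[of s' t'] st' by (simp add: d_def)
  ultimately show False unfolding eq by (simp add: e_def dist_real_def field_simps abs_if split: if_splits)
qed

lemma frechet_derivative_bounded_linear: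
  assumes "(f has_derivative f') (at x)" "bounded_linear L"
  shows "frechet_derivative (\<lambda>y. L (f y)) (at x) v = L (frechet_derivative f (at x) v)"
  using frechet_derivative_at[OF bounded_linear.has_derivative[OF assms(2,1)]] frechet_derivative_at[OF assms(1)]
  by metis

lemma frechet_derivative_cong:
  assumes "open S" "x \<in> S" "\<And>y. y \<in> S \<Longrightarrow> f y = g y"
  shows "frechet_derivative f (at x) = frechet_derivative g (at x)"
proof -
  have "(f has_derivative D) (at x) \<longleftrightarrow> (g has_derivative D) (at x)" for D
    using has_derivative_transform_within_open[OF _ assms(1,2)] assms(3) by metis
  then show ?thesis by (simp add: frechet_derivative_def)
qed

lemma symmetric_second_derivative:
  fixes f :: "'a::euclidean_space \<Rightarrow> 'b::euclidean_space"
  assumes S: "open S" "x \<in> S" and f: "smooth_on S f"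
  shows "frechet_derivative (\<lambda>y. frechet_derivative f (at y) a) (at x) b
       = frechet_derivative (\<lambda>y. frechet_derivative f (at y) b) (at x) a"
proof (rule euclidean_eqI)
  fix i :: 'b
  have L: "bounded_linear (\<lambda>v::'b. v \<bullet> i)" by (rule bounded_linear_inner_left)
  have "frechet_derivative (\<lambda>y. frechet_derivative f (at y) a) (at x) b \<bullet> i =
     frechet_derivative (\<lambda>y. frechet_derivative (\<lambda>z. f z \<bullet> i) (at y) a) (at x) b" for a b
  proof -
    have "frechet_derivative (\<lambda>y. frechet_derivative f (at y) a) (at x) b \<bullet> i =
      frechet_derivative (\<lambda>y. frechet_derivative f (at y) a \<bullet> i) (at x) b"
      by (rule frechet_derivative_bounded_linear[OF smooth_onD(1)[OF smooth_onD(3)[OF f] S(2)] L, symmetric])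
    also have "frechet_derivative (\<lambda>y. frechet_derivative f (at y) a \<bullet> i) (at x) =
      frechet_derivative (\<lambda>y. frechet_derivative (\<lambda>z. f z \<bullet> i) (at y) a) (at x)"
      by (rule frechet_derivative_cong[OF S])
        (rule frechet_derivative_bounded_linear[OF smooth_onD(1)[OF f] L, symmetric])
    finally show ?thesis .
  qed
  then show "frechet_derivative (\<lambda>y. frechet_derivative f (at y) a) (at x) b \<bullet> i
       = frechet_derivative (\<lambda>y. frechet_derivative f (at y) b) (at x) a \<bullet> i"
    using symmetric_second_derivative_real[OF S smooth_on_bounded_linear[OF S(1) L f]] by simp
qed

lemma frechet_derivative_Basis_expansion:
  fixes \<psi> :: "'a::euclidean_space \<Rightarrow> 'b::euclidean_space"
  assumes "smooth_on S \<psi>" "y \<in> S"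
  shows "frechet_derivative \<psi> (at y) v = (\<Sum>b\<in>Basis. (v \<bullet> b) *\<^sub>R frechet_derivative \<psi> (at y) b)"
  by (rule linear_Basis_expansion[OF has_derivative_linear[OF smooth_onD(1)[OF assms]]])

lemma smooth_on_derivative_along:
  fixes \<psi> :: "'a::euclidean_space \<Rightarrow> 'b::euclidean_space" and x :: "'c::euclidean_space \<Rightarrow> 'a"
  assumes "open S" "smooth_on S \<psi>" and "open T" "smooth_on T x" "smooth_on T h" "\<And>p. p \<in> T \<Longrightarrow> x p \<in> S"
  shows "smooth_on T (\<lambda>p. frechet_derivative \<psi> (at (x p)) (h p))"
proof -
  have "smooth_on T (\<lambda>p. \<Sum>b\<in>Basis. (h p \<bullet> b) *\<^sub>R frechet_derivative \<psi> (at (x p)) b)"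
    by (intro smooth_on_sum smooth_on_scaleR assms smooth_on_bounded_linear[OF _ bounded_linear_inner_left]
        smooth_on_compose[OF assms(3,1,6)] smooth_onD(3))
  then show ?thesis
    by (rule smooth_on_cong[OF assms(3), rotated])
      (simp add: frechet_derivative_Basis_expansion[OF assms(2,6), symmetric])
qed

text \<open>
  The product rule for \<open>y \<mapsto> d\<psi>\<^sub>y(h y)\<close>, with the second-order term brought by symmetry into a
  form in which the field \<open>h\<close> enters as the direction of differentiation.
\<close>

lemma derivative_of_lie_derivative:
  fixes \<psi> :: "'a::euclidean_space \<Rightarrow> 'b::euclidean_space" and h :: "'a \<Rightarrow> 'a"
  assumes S: "open S" "\<xi> \<in> S" and \<psi>: "smooth_on S \<psi>" and h: "smooth_on S h"
  shows "frechet_derivative (\<lambda>y. frechet_derivative \<psi> (at y) (h y)) (at \<xi>) a =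
    frechet_derivative \<psi> (at \<xi>) (frechet_derivative h (at \<xi>) a) +
    frechet_derivative (\<lambda>y. frechet_derivative \<psi> (at y) a) (at \<xi>) (h \<xi>)"
proof -
  let ?D = "frechet_derivative"
  have "((\<lambda>y. \<Sum>b\<in>Basis. (h y \<bullet> b) *\<^sub>R ?D \<psi> (at y) b) has_derivative
    (\<lambda>a. \<Sum>b\<in>Basis. (h \<xi> \<bullet> b) *\<^sub>R ?D (\<lambda>y. ?D \<psi> (at y) b) (at \<xi>) a + (?D h (at \<xi>) a \<bullet> b) *\<^sub>R ?D \<psi> (at \<xi>) b)) (at \<xi>)"
    by (intro has_derivative_sum has_derivative_scaleR has_derivative_inner_left smooth_onD(1)[OF h S(2)]
        smooth_onD(1)[OF smooth_onD(3)[OF \<psi>] S(2)])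
  then have "((\<lambda>y. ?D \<psi> (at y) (h y)) has_derivative
    (\<lambda>a. \<Sum>b\<in>Basis. (h \<xi> \<bullet> b) *\<^sub>R ?D (\<lambda>y. ?D \<psi> (at y) b) (at \<xi>) a + (?D h (at \<xi>) a \<bullet> b) *\<^sub>R ?D \<psi> (at \<xi>) b)) (at \<xi>)"
    by (rule has_derivative_transform_within_open[OF _ S])
      (simp add: frechet_derivative_Basis_expansion[OF \<psi>, symmetric])
  from frechet_derivative_at[OF this, symmetric]
  have "?D (\<lambda>y. ?D \<psi> (at y) (h y)) (at \<xi>) a =
    (\<Sum>b\<in>Basis. (h \<xi> \<bullet> b) *\<^sub>R ?D (\<lambda>y. ?D \<psi> (at y) b) (at \<xi>) a) + (\<Sum>b\<in>Basis. (?D h (at \<xi>) a \<bullet> b) *\<^sub>R ?D \<psi> (at \<xi>) b)"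
    by (simp add: sum.distrib)
  also have "(\<Sum>b\<in>Basis. (h \<xi> \<bullet> b) *\<^sub>R ?D (\<lambda>y. ?D \<psi> (at y) b) (at \<xi>) a) =
     (\<Sum>b\<in>Basis. (h \<xi> \<bullet> b) *\<^sub>R ?D (\<lambda>y. ?D \<psi> (at y) a) (at \<xi>) b)"
    by (simp add: symmetric_second_derivative[OF S \<psi>, of _ a])
  finally show ?thesis
    by (simp add: frechet_derivative_Basis_expansion[OF \<psi> S(2), symmetric]
      frechet_derivative_Basis_expansion[OF smooth_onD(3)[OF \<psi>] S(2), symmetric])
qed

text \<open>
  The classical \<open>L\<^sub>g L\<^sub>h - L\<^sub>h L\<^sub>g = L\<^bsub>[g,h]\<^esub>\<close>: the second-order terms are equal by symmetry, and
  the first-order terms make up the bracket.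
\<close>

lemma lie_derivative_commutator:
  fixes \<psi> :: "'a::euclidean_space \<Rightarrow> 'b::euclidean_space" and g h :: "'a \<Rightarrow> 'a"
  assumes S: "open S" "\<xi> \<in> S" and \<psi>: "smooth_on S \<psi>" and "smooth_on S g" "smooth_on S h"
  shows "frechet_derivative (\<lambda>y. frechet_derivative \<psi> (at y) (h y)) (at \<xi>) (g \<xi>) -
    frechet_derivative (\<lambda>y. frechet_derivative \<psi> (at y) (g y)) (at \<xi>) (h \<xi>) =
    frechet_derivative \<psi> (at \<xi>) (lie_bracket g h \<xi>)"
  unfolding derivative_of_lie_derivative[OF S \<psi> assms(4)] derivative_of_lie_derivative[OF S \<psi> assms(5)]
    lie_bracket_def linear_diff[OF has_derivative_linear[OF smooth_onD(1)[OF \<psi> S(2)]]]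
    symmetric_second_derivative[OF S \<psi>, of "g \<xi>" "h \<xi>"]
  by simp

section \<open>Smooth functions of finite order on jet spaces\<close>

lemma has_vector_derivative_linear_line:
  fixes L :: "'a::real_vector \<Rightarrow> 'b::real_normed_vector"
  assumes "linear L"
  shows "((\<lambda>t. L (p + t *\<^sub>R v)) has_vector_derivative L v) (at s)"
  unfolding linear_add[OF assms] linear_cmul[OF assms] by (auto intro!: derivative_eq_intros)

lemma dir_deriv_eqI:
  "((\<lambda>t. F (p + t *\<^sub>R v)) has_vector_derivative w) (at 0) \<Longrightarrow> dir_deriv F p v = w"
  unfolding dir_deriv_def by (rule vector_derivative_at)

text \<open>
  An open set \<open>P\<close> in a space with countably many vector coordinates \<open>\<kappa> j\<close> and a distinguished
  finite-dimensional projection \<open>\<pi>\<close>, which maps \<open>P\<close> into an open set \<open>S\<close>. On the state side, the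
  points are \<open>(x, u, u', \<dots>)\<close> and the projection gives \<open>x\<close>; on the output side, the points are
  \<open>(z, z', \<dots>)\<close> and the projection gives \<open>(z, z')\<close>.
\<close>

locale jet_space =
  fixes \<pi> :: "'p::{real_vector, topological_space} \<Rightarrow> 'e::euclidean_space"
    and \<kappa> :: "nat \<Rightarrow> 'p \<Rightarrow> 'c::euclidean_space"
    and coords :: "nat \<Rightarrow> 'p \<Rightarrow> 'w"
    and S :: "'e set" and P :: "'p set"
  assumes linear_\<pi>: "linear \<pi>" and linear_\<kappa>: "linear (\<kappa> j)"
    and continuous_\<pi>: "continuous_on UNIV \<pi>" and continuous_\<kappa>: "continuous_on UNIV (\<kappa> j)"
    and continuous_line: "continuous_on UNIV (\<lambda>t. p + t *\<^sub>R v)"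
    and open_S: "open S" and open_P: "open P" and \<pi>_P: "p \<in> P \<Longrightarrow> \<pi> p \<in> S"
    and coords_eqD: "1 \<le> N \<Longrightarrow> coords N p = coords N q \<Longrightarrow> \<pi> p = \<pi> q \<and> (\<forall>j\<le>N. \<kappa> j p = \<kappa> j q)"
begin

text \<open>
  Each member depends on finitely many coordinates, but their number is not bounded. Structural
  induction over the algebra takes the place of calculus in a varying number of variables.
\<close>

inductive jet_poly :: "('p \<Rightarrow> real) \<Rightarrow> bool" where
  base: "smooth_on S h \<Longrightarrow> jet_poly (\<lambda>p. h (\<pi> p))"
| coord: "b \<in> Basis \<Longrightarrow> jet_poly (\<lambda>p. \<kappa> j p \<bullet> b)"
| add: "jet_poly F \<Longrightarrow> jet_poly G \<Longrightarrow> jet_poly (\<lambda>p. F p + G p)"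
| mult: "jet_poly F \<Longrightarrow> jet_poly G \<Longrightarrow> jet_poly (\<lambda>p. F p * G p)"

text \<open>
  Vector-valued maps whose components coincide on \<open>P\<close> with members of the algebra. Agreement
  is required on \<open>P\<close> only, since iterated directional derivatives are controlled there and
  nowhere else.
\<close>

definition jet_fun :: "('p \<Rightarrow> 'b::euclidean_space) \<Rightarrow> bool" where
  "jet_fun F \<longleftrightarrow> (\<forall>b\<in>Basis. \<exists>G. jet_poly G \<and> (\<forall>p\<in>P. F p \<bullet> b = G p))"

definition jet_field :: "('p \<Rightarrow> 'p) \<Rightarrow> bool" where
  "jet_field Y \<longleftrightarrow> jet_fun (\<lambda>p. \<pi> (Y p)) \<and> (\<forall>j. jet_fun (\<lambda>p. \<kappa> j (Y p)))"

text \<open>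
  A curve through \<open>p\<close> that is differentiable in every coordinate, with velocity \<open>v\<close>. Since there
  is no norm on the space, this is the notion of differentiable curve for which the chain rule is
  proved. Straight lines do not suffice, as the prolongation bends them.
\<close>

definition tangent :: "(real \<Rightarrow> 'p) \<Rightarrow> 'p \<Rightarrow> 'p \<Rightarrow> bool" where
  "tangent \<gamma> p v \<longleftrightarrow> p \<in> P \<and> \<gamma> 0 = p \<and> eventually (\<lambda>t. \<gamma> t \<in> P) (nhds 0) \<and>
     ((\<lambda>t. \<pi> (\<gamma> t)) has_vector_derivative \<pi> v) (at 0) \<and>
     (\<forall>j. ((\<lambda>t. \<kappa> j (\<gamma> t)) has_vector_derivative \<kappa> j v) (at 0))"

lemma jet_poly_const: "jet_poly (\<lambda>p. c)"
  using base[OF smooth_on_const] .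

lemma jet_poly_sum: "(\<And>i. i \<in> I \<Longrightarrow> jet_poly (F i)) \<Longrightarrow> jet_poly (\<lambda>p. \<Sum>i\<in>I. F i p)"
  by (induction I rule: infinite_finite_induct) (auto intro: jet_poly_const add)

lemma jet_poly_continuous: "jet_poly F \<Longrightarrow> continuous_on P F"
proof (induction rule: jet_poly.induct)
  case (base h)
  have "continuous_on P \<pi>" using continuous_\<pi> continuous_on_subset by blast
  then show ?case
    by (rule continuous_on_compose2[OF smooth_onD(2)[OF base]]) (use \<pi>_P in auto)
next
  case (coord b j)
  then show ?case by (intro continuous_intros continuous_on_subset[OF continuous_\<kappa>]) auto
qed (auto intro: continuous_intros)

lemma jet_poly_order:
  "jet_poly F \<Longrightarrow> \<exists>N. \<forall>M\<ge>N. \<forall>p q. coords M p = coords M q \<longrightarrow> F p = F q"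
proof (induction rule: jet_poly.induct)
  case (base h)
  then show ?case using coords_eqD by metis
next
  case (coord b j)
  then show ?case using coords_eqD by (intro exI[of _ "Suc j"]) (metis Suc_leD le_trans One_nat_def Suc_le_mono le0)
next
  case (add F G)
  then obtain N N' where "\<forall>M\<ge>N. \<forall>p q. coords M p = coords M q \<longrightarrow> F p = F q"
    "\<forall>M\<ge>N'. \<forall>p q. coords M p = coords M q \<longrightarrow> G p = G q" by blast
  then show ?case by (intro exI[of _ "N + N'"]) (metis add_leE)
next
  case (mult F G)
  then obtain N N' where "\<forall>M\<ge>N. \<forall>p q. coords M p = coords M q \<longrightarrow> F p = F q"
    "\<forall>M\<ge>N'. \<forall>p q. coords M p = coords M q \<longrightarrow> G p = G q" by blast
  then show ?case by (intro exI[of _ "N + N'"]) (metis add_leE)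
qed

text \<open>
  Each function of the algebra has a derivative \<open>F' p v\<close> that satisfies the chain rule along all
  tangent curves. The derivative in the direction of a field with coefficients in the algebra is
  again in the algebra; constant fields and Cartan fields are both of this kind.
\<close>

lemma jet_poly_derivation:
  assumes "jet_poly F"
  shows "\<exists>F'. (\<forall>\<gamma> p v. tangent \<gamma> p v \<longrightarrow> ((\<lambda>t. F (\<gamma> t)) has_real_derivative F' p v) (at 0)) \<and>
    (\<forall>Y. jet_field Y \<longrightarrow> (\<exists>G. jet_poly G \<and> (\<forall>p\<in>P. F' p (Y p) = G p)))"
  using assms
proof (induction rule: jet_poly.induct)
  case (base h)
  let ?F' = "\<lambda>p v. frechet_derivative h (at (\<pi> p)) (\<pi> v)"
  have dh: "(h has_derivative frechet_derivative h (at (\<pi> p))) (at (\<pi> p))" if "p \<in> P" for p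
    using smooth_onD(1)[OF base \<pi>_P[OF that]] .
  have "((\<lambda>t. h (\<pi> (\<gamma> t))) has_real_derivative ?F' p v) (at 0)" if "tangent \<gamma> p v" for \<gamma> p v
  proof -
    have \<gamma>: "p \<in> P" "\<gamma> 0 = p" "((\<lambda>t. \<pi> (\<gamma> t)) has_vector_derivative \<pi> v) (at 0)"
      using that by (auto simp: tangent_def)
    show ?thesis
      using has_vector_derivative_compose[OF \<gamma>(3)] dh[OF \<gamma>(1)] \<gamma>(2)
      unfolding has_real_derivative_iff_has_vector_derivative by blast
  qed
  moreover have "\<exists>G. jet_poly G \<and> (\<forall>p\<in>P. ?F' p (Y p) = G p)" if Y: "jet_field Y" for Y
  proof -
    have "\<forall>b\<in>Basis. \<exists>G. jet_poly G \<and> (\<forall>p\<in>P. \<pi> (Y p) \<bullet> b = G p)"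
      using Y by (simp add: jet_field_def jet_fun_def)
    then obtain G where G: "\<And>b. b \<in> Basis \<Longrightarrow> jet_poly (G b)" "\<And>b p. b \<in> Basis \<Longrightarrow> p \<in> P \<Longrightarrow> \<pi> (Y p) \<bullet> b = G b p"
      by metis
    show ?thesis
    proof (intro exI conjI ballI)
      show "jet_poly (\<lambda>p. \<Sum>b\<in>Basis. G b p * frechet_derivative h (at (\<pi> p)) b)"
        by (intro jet_poly_sum mult G jet_poly.base[OF smooth_onD(3)[OF base]])
      fix p assume p: "p \<in> P"
      show "?F' p (Y p) = (\<Sum>b\<in>Basis. G b p * frechet_derivative h (at (\<pi> p)) b)"
        using G(2)[OF _ p] linear_Basis_expansion[OF has_derivative_linear[OF dh[OF p]], of "\<pi> (Y p)"]
        by simp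
    qed
  qed
  ultimately show ?case by (intro exI[of _ ?F']) blast
next
  case (coord b j)
  have "((\<lambda>t. \<kappa> j (\<gamma> t) \<bullet> b) has_real_derivative \<kappa> j v \<bullet> b) (at 0)" if "tangent \<gamma> p v" for \<gamma> p v
    using that bounded_linear.has_vector_derivative[OF bounded_linear_inner_left]
    unfolding has_real_derivative_iff_has_vector_derivative tangent_def by blast
  then show ?case using coord
    by (intro exI[of _ "\<lambda>p v. \<kappa> j v \<bullet> b"]) (auto simp: jet_field_def jet_fun_def)
next
  case (add F G)
  then obtain F' G' where F': "\<And>\<gamma> p v. tangent \<gamma> p v \<Longrightarrow> ((\<lambda>t. F (\<gamma> t)) has_real_derivative F' p v) (at 0)"
     "\<And>Y. jet_field Y \<Longrightarrow> \<exists>G. jet_poly G \<and> (\<forall>p\<in>P. F' p (Y p) = G p)"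
    and G': "\<And>\<gamma> p v. tangent \<gamma> p v \<Longrightarrow> ((\<lambda>t. G (\<gamma> t)) has_real_derivative G' p v) (at 0)"
     "\<And>Y. jet_field Y \<Longrightarrow> \<exists>G. jet_poly G \<and> (\<forall>p\<in>P. G' p (Y p) = G p)" by blast
  show ?case
  proof (intro exI[of _ "\<lambda>p v. F' p v + G' p v"] conjI allI impI)
    fix \<gamma> p v assume "tangent \<gamma> p v"
    then show "((\<lambda>t. F (\<gamma> t) + G (\<gamma> t)) has_real_derivative F' p v + G' p v) (at 0)"
      by (intro DERIV_add F' G')
  next
    fix Y assume "jet_field Y"
    then obtain H K where "jet_poly H" "\<And>p. p \<in> P \<Longrightarrow> F' p (Y p) = H p" "jet_poly K" "\<And>p. p \<in> P \<Longrightarrow> G' p (Y p) = K p"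
      using F'(2) G'(2) by meson
    then show "\<exists>L. jet_poly L \<and> (\<forall>p\<in>P. F' p (Y p) + G' p (Y p) = L p)"
      by (intro exI[of _ "\<lambda>p. H p + K p"]) (auto intro: jet_poly.add)
  qed
next
  case (mult F G)
  then obtain F' G' where F': "\<And>\<gamma> p v. tangent \<gamma> p v \<Longrightarrow> ((\<lambda>t. F (\<gamma> t)) has_real_derivative F' p v) (at 0)"
     "\<And>Y. jet_field Y \<Longrightarrow> \<exists>G. jet_poly G \<and> (\<forall>p\<in>P. F' p (Y p) = G p)"
    and G': "\<And>\<gamma> p v. tangent \<gamma> p v \<Longrightarrow> ((\<lambda>t. G (\<gamma> t)) has_real_derivative G' p v) (at 0)"
     "\<And>Y. jet_field Y \<Longrightarrow> \<exists>G. jet_poly G \<and> (\<forall>p\<in>P. G' p (Y p) = G p)" by blast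
  show ?case
  proof (intro exI[of _ "\<lambda>p v. F' p v * G p + G' p v * F p"] conjI allI impI)
    fix \<gamma> p v assume t: "tangent \<gamma> p v"
    then have "\<gamma> 0 = p" by (simp add: tangent_def)
    then show "((\<lambda>t. F (\<gamma> t) * G (\<gamma> t)) has_real_derivative F' p v * G p + G' p v * F p) (at 0)"
      using DERIV_mult[OF F'(1)[OF t] G'(1)[OF t]] by simp
  next
    fix Y assume "jet_field Y"
    then obtain H K where "jet_poly H" "\<And>p. p \<in> P \<Longrightarrow> F' p (Y p) = H p" "jet_poly K" "\<And>p. p \<in> P \<Longrightarrow> G' p (Y p) = K p"
      using F'(2) G'(2) by meson
    then show "\<exists>L. jet_poly L \<and> (\<forall>p\<in>P. F' p (Y p) * G p + G' p (Y p) * F p = L p)"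
      using mult(1,2)
      by (intro exI[of _ "\<lambda>p. H p * G p + K p * F p"]) (auto intro!: jet_poly.add jet_poly.mult)
  qed
qed

lemma jet_fun_cong: "jet_fun F \<Longrightarrow> (\<And>p. p \<in> P \<Longrightarrow> F p = G p) \<Longrightarrow> jet_fun G"
  by (simp add: jet_fun_def)

lemma jet_fun_components:
  assumes "jet_fun (F :: 'p \<Rightarrow> 'b::euclidean_space)"
  obtains G where "\<And>b. b \<in> (Basis :: 'b set) \<Longrightarrow> jet_poly (G b)" "\<And>p. p \<in> P \<Longrightarrow> F p = (\<Sum>b\<in>Basis. G b p *\<^sub>R b)"
proof -
  from assms obtain G where "\<And>b. b \<in> Basis \<Longrightarrow> jet_poly (G b)" "\<And>b p. b \<in> Basis \<Longrightarrow> p \<in> P \<Longrightarrow> F p \<bullet> b = G b p"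
    unfolding jet_fun_def by metis
  then show ?thesis using that[of G] euclidean_representation[of "F _"] by (metis (no_types, lifting) sum.cong)
qed

lemma jet_fun_sum_scaleR:
  assumes "\<And>i. i \<in> I \<Longrightarrow> jet_poly (G i)"
  shows "jet_fun (\<lambda>p. \<Sum>i\<in>I. G i p *\<^sub>R (c i :: 'b::euclidean_space))"
  unfolding jet_fun_def
proof
  fix b :: 'b assume "b \<in> Basis"
  show "\<exists>H. jet_poly H \<and> (\<forall>p\<in>P. (\<Sum>i\<in>I. G i p *\<^sub>R c i) \<bullet> b = H p)"
    by (intro exI[of _ "\<lambda>p. \<Sum>i\<in>I. G i p * (c i \<bullet> b)"] conjI jet_poly_sum jet_poly.mult assms jet_poly_const)
      (auto simp: inner_sum_left)
qed

lemma jet_fun_derivation: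
  assumes "jet_fun (F :: 'p \<Rightarrow> 'b::euclidean_space)"
  shows "\<exists>F'. (\<forall>\<gamma> p v. tangent \<gamma> p v \<longrightarrow> ((\<lambda>t. F (\<gamma> t)) has_vector_derivative F' p v) (at 0)) \<and>
    (\<forall>Y. jet_field Y \<longrightarrow> jet_fun (\<lambda>p. F' p (Y p)))"
proof -
  obtain G where G: "\<And>b. b \<in> (Basis :: 'b set) \<Longrightarrow> jet_poly (G b)" "\<And>p. p \<in> P \<Longrightarrow> F p = (\<Sum>b\<in>Basis. G b p *\<^sub>R b)"
    using jet_fun_components[OF assms] by blast
  obtain G' where G': "\<And>b \<gamma> p v. b \<in> (Basis :: 'b set) \<Longrightarrow> tangent \<gamma> p v \<Longrightarrow> ((\<lambda>t. G b (\<gamma> t)) has_real_derivative G' b p v) (at 0)"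
    "\<And>b Y. b \<in> (Basis :: 'b set) \<Longrightarrow> jet_field Y \<Longrightarrow> \<exists>H. jet_poly H \<and> (\<forall>p\<in>P. G' b p (Y p) = H p)"
    using jet_poly_derivation[OF G(1)] by metis
  show ?thesis
  proof (intro exI[of _ "\<lambda>p v. \<Sum>b\<in>Basis. G' b p v *\<^sub>R b"] conjI allI impI)
    fix \<gamma> p v assume t: "tangent \<gamma> p v"
    then have ev: "eventually (\<lambda>t. (\<Sum>b\<in>Basis. G b (\<gamma> t) *\<^sub>R b) = F (\<gamma> t)) (nhds 0)"
      unfolding tangent_def by (auto elim!: eventually_mono simp: G(2))
    have "((\<lambda>t. \<Sum>b\<in>Basis. G b (\<gamma> t) *\<^sub>R b) has_vector_derivative (\<Sum>b\<in>Basis. G' b p v *\<^sub>R b)) (at 0)"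
      using G'(1)[OF _ t]
      by (auto intro!: has_vector_derivative_sum derivative_eq_intros)
    then show "((\<lambda>t. F (\<gamma> t)) has_vector_derivative (\<Sum>b\<in>Basis. G' b p v *\<^sub>R b)) (at 0)"
      by (rule has_vector_derivative_cong_ev[THEN iffD1, rotated 2])
        (use ev eventually_nhds_x_imp_x[OF ev] in auto)
  next
    fix Y assume "jet_field Y"
    then have "\<forall>b\<in>Basis. \<exists>H. jet_poly H \<and> (\<forall>p\<in>P. H p = G' b p (Y p))"
      using G'(2) by fastforce
    then obtain H where "\<And>b. b \<in> (Basis :: 'b set) \<Longrightarrow> jet_poly (H b)"
      "\<And>b p. b \<in> (Basis :: 'b set) \<Longrightarrow> p \<in> P \<Longrightarrow> H b p = G' b p (Y p)"
      by metis
    then show "jet_fun (\<lambda>p. \<Sum>b\<in>Basis. G' b p (Y p) *\<^sub>R b)"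
      by (intro jet_fun_cong[OF jet_fun_sum_scaleR[of Basis H]]) auto
  qed
qed

lemma tangent_line:
  assumes "p \<in> P"
  shows "tangent (\<lambda>t. p + t *\<^sub>R v) p v"
proof -
  have "open ((\<lambda>t. p + t *\<^sub>R v) -` P)"
    by (rule open_vimage[OF open_P continuous_line])
  then have "eventually (\<lambda>t. t \<in> (\<lambda>t. p + t *\<^sub>R v) -` P) (nhds 0)"
    by (rule eventually_nhds_in_open) (use assms in simp)
  then show ?thesis
    using assms has_vector_derivative_linear_line[OF linear_\<pi>] has_vector_derivative_linear_line[OF linear_\<kappa>]
    by (simp add: tangent_def)
qed

lemma dir_deriv_along_curve:
  assumes "jet_fun F" "tangent \<gamma> p v"
  shows "((\<lambda>t. F (\<gamma> t)) has_vector_derivative dir_deriv F p v) (at 0)"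
proof -
  obtain F' where F': "\<And>\<gamma> p v. tangent \<gamma> p v \<Longrightarrow> ((\<lambda>t. F (\<gamma> t)) has_vector_derivative F' p v) (at 0)"
    using jet_fun_derivation[OF assms(1)] by blast
  have "p \<in> P" using assms(2) by (simp add: tangent_def)
  then have "dir_deriv F p v = F' p v"
    unfolding dir_deriv_def by (intro vector_derivative_at F' tangent_line)
  then show ?thesis using F' assms(2) by simp
qed

lemma jet_fun_dir_deriv:
  assumes "jet_fun F" "jet_field Y"
  shows "jet_fun (\<lambda>p. dir_deriv F p (Y p))"
proof -
  obtain F' where F': "\<And>\<gamma> p v. tangent \<gamma> p v \<Longrightarrow> ((\<lambda>t. F (\<gamma> t)) has_vector_derivative F' p v) (at 0)"
    "jet_fun (\<lambda>p. F' p (Y p))"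
    using jet_fun_derivation[OF assms(1)] assms(2) by blast
  have "dir_deriv F p v = F' p v" if "p \<in> P" for p v
    unfolding dir_deriv_def by (intro vector_derivative_at F' tangent_line that)
  then show ?thesis using F'(2) jet_fun_cong by fastforce
qed

lemma dir_deriv_cong:
  assumes "p \<in> P" "\<And>q. q \<in> P \<Longrightarrow> F q = G q"
  shows "dir_deriv F p v = dir_deriv G p v"
proof -
  have "eventually (\<lambda>t. p + t *\<^sub>R v \<in> P) (nhds 0)"
    using tangent_line[OF assms(1)] by (simp add: tangent_def)
  then have "eventually (\<lambda>t. F (p + t *\<^sub>R v) = G (p + t *\<^sub>R v)) (nhds 0)"
    by (rule eventually_mono) (use assms in auto)
  then show ?thesis
    unfolding dir_deriv_def by (intro vector_derivative_cong_eq) auto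
qed

lemma jet_fun_continuous: "jet_fun F \<Longrightarrow> continuous_on P F"
proof -
  assume "jet_fun F"
  then obtain G where G: "\<And>b. b \<in> Basis \<Longrightarrow> jet_poly (G b)" "\<And>p. p \<in> P \<Longrightarrow> F p = (\<Sum>b\<in>Basis. G b p *\<^sub>R b)"
    using jet_fun_components by blast
  have "continuous_on P (\<lambda>p. \<Sum>b\<in>Basis. G b p *\<^sub>R b)"
    by (intro continuous_intros jet_poly_continuous G)
  then show "continuous_on P F" using G(2) by (metis (no_types, lifting) continuous_on_cong)
qed

lemma jet_fun_const: "jet_fun (\<lambda>p. c)"
  unfolding jet_fun_def using jet_poly_const by blast

lemma jet_field_const: "jet_field (\<lambda>p. v)"
  by (simp add: jet_field_def jet_fun_const)

text \<open>
  Directional derivatives stay in the algebra, and all its members are continuous and depend on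
  finitely many coordinates.
\<close>

theorem jet_fun_smooth:
  assumes "jet_fun F"
  shows "jet_smooth_on coords P F"
proof -
  have "jet_ck_on r P F" for r
    using assms
  proof (induction r arbitrary: F)
    case 0
    then show ?case by (simp add: jet_fun_continuous)
  next
    case (Suc r)
    have "(\<lambda>t. F (p + t *\<^sub>R v)) differentiable (at 0)" if "p \<in> P" for p v
      using dir_deriv_along_curve[OF Suc.prems tangent_line[OF that]] differentiableI_vector by blast
    then show ?case using Suc.IH[OF jet_fun_dir_deriv[OF Suc.prems jet_field_const]] by simp
  qed
  moreover have "locally_finite_order_on coords P F"
  proof -
    obtain G where G: "\<And>b. b \<in> Basis \<Longrightarrow> jet_poly (G b)" "\<And>p. p \<in> P \<Longrightarrow> F p = (\<Sum>b\<in>Basis. G b p *\<^sub>R b)"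
      using jet_fun_components[OF assms] by blast
    obtain N where N: "\<And>b M p q. b \<in> Basis \<Longrightarrow> N b \<le> M \<Longrightarrow> coords M p = coords M q \<Longrightarrow> G b p = G b q"
      using jet_poly_order[OF G(1)] by metis
    have "F p = F q" if "p \<in> P" "q \<in> P" "coords (sum N Basis) p = coords (sum N Basis) q" for p q
      using N[OF _ member_le_sum that(3)] G(2) that by (auto intro!: sum.cong)
    then show ?thesis unfolding locally_finite_order_on_def using open_P by blast
  qed
  ultimately show ?thesis by (simp add: jet_smooth_on_def)
qed

lemma jet_fun_add: "jet_fun F \<Longrightarrow> jet_fun G \<Longrightarrow> jet_fun (\<lambda>p. F p + G p)"
  unfolding jet_fun_def inner_add_left by (metis jet_poly.add)

lemma jet_fun_scaleR:
  fixes h :: "'p \<Rightarrow> real" and F :: "'p \<Rightarrow> 'b::euclidean_space"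
  assumes "jet_fun h" "jet_fun F"
  shows "jet_fun (\<lambda>p. h p *\<^sub>R F p)"
  unfolding jet_fun_def
proof
  fix b :: 'b assume b: "b \<in> Basis"
  obtain H where "jet_poly H" "\<And>p. p \<in> P \<Longrightarrow> h p = H p"
    using assms(1) by (auto simp: jet_fun_def)
  moreover obtain G where "jet_poly G" "\<And>p. p \<in> P \<Longrightarrow> F p \<bullet> b = G p"
    using assms(2) b by (auto simp: jet_fun_def)
  ultimately show "\<exists>K. jet_poly K \<and> (\<forall>p\<in>P. (h p *\<^sub>R F p) \<bullet> b = K p)"
    by (intro exI[of _ "\<lambda>p. H p * G p"]) (auto intro: jet_poly.mult)
qed

lemma jet_fun_sum: "(\<And>i. i \<in> I \<Longrightarrow> jet_fun (F i)) \<Longrightarrow> jet_fun (\<lambda>p. \<Sum>i\<in>I. F i p)"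
  by (induction I rule: infinite_finite_induct) (auto intro: jet_fun_const jet_fun_add)

lemma jet_fun_linear:
  assumes "jet_fun F" "linear L"
  shows "jet_fun (\<lambda>p. L (F p))"
proof -
  obtain G where G: "\<And>b. b \<in> Basis \<Longrightarrow> jet_poly (G b)" "\<And>p. p \<in> P \<Longrightarrow> F p = (\<Sum>b\<in>Basis. G b p *\<^sub>R b)"
    using jet_fun_components[OF assms(1)] by blast
  show ?thesis
    by (rule jet_fun_cong[OF jet_fun_sum_scaleR[of Basis G "L"]])
      (auto simp: G linear_sum[OF assms(2)] linear_cmul[OF assms(2)])
qed

lemma jet_fun_inner: 
  assumes "jet_fun F" "jet_fun G"
  shows "jet_fun (\<lambda>p. F p \<bullet> G p)"
proof -
  have "jet_fun (\<lambda>p. \<Sum>b\<in>Basis. (F p \<bullet> b) *\<^sub>R (G p \<bullet> b))"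
    using assms by (intro jet_fun_sum jet_fun_scaleR jet_fun_linear[of F "\<lambda>v. v \<bullet> _"] jet_fun_linear[of G "\<lambda>v. v \<bullet> _"])
      (auto intro: bounded_linear.linear bounded_linear_inner_left)
  then show ?thesis
  proof (rule jet_fun_cong)
    show "(\<Sum>b\<in>Basis. (F p \<bullet> b) *\<^sub>R (G p \<bullet> b)) = F p \<bullet> G p" for p
      using euclidean_inner[of "F p" "G p"] by simp
  qed
qed

lemma jet_fun_base:
  assumes "smooth_on S h" shows "jet_fun (\<lambda>p. h (\<pi> p))"
  unfolding jet_fun_def
  using base[OF smooth_on_bounded_linear[OF open_S bounded_linear_inner_left assms]] by blast

lemma jet_fun_Pair:
  fixes F :: "'p \<Rightarrow> 'b::euclidean_space" and G :: "'p \<Rightarrow> 'd::euclidean_space"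
  assumes "jet_fun F" "jet_fun G"
  shows "jet_fun (\<lambda>p. (F p, G p))"
proof -
  have "linear (\<lambda>x::'b. (x, 0::'d))" "linear (\<lambda>y::'d. (0::'b, y))"
    by (auto intro!: linearI)
  from jet_fun_add[OF jet_fun_linear[OF assms(1) this(1)] jet_fun_linear[OF assms(2) this(2)]]
  show ?thesis by simp
qed

lemma dir_deriv_base:
  assumes "p \<in> P" "smooth_on S h"
  shows "dir_deriv (\<lambda>p. h (\<pi> p)) p v = frechet_derivative h (at (\<pi> p)) (\<pi> v)"
  using has_vector_derivative_compose[OF has_vector_derivative_linear_line[OF linear_\<pi>, of p v 0], of h]
    smooth_onD(1)[OF assms(2) \<pi>_P[OF assms(1)]]
  by (intro dir_deriv_eqI) simp

lemma dir_deriv_coord: "dir_deriv (\<kappa> j) p v = \<kappa> j v"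
  by (rule dir_deriv_eqI[OF has_vector_derivative_linear_line[OF linear_\<kappa>]])

lemma jet_fun_coord: "jet_fun (\<kappa> j)"
  unfolding jet_fun_def using coord by blast

end

section \<open>First integrals in a chart\<close>

text \<open>
  The map \<open>v \<mapsto> (L v, v \<bullet> a)\<close> is onto a space of the same dimension, hence injective, and it sends
  the component of \<open>b\<close> orthogonal to \<open>a\<close> to zero.
\<close>

lemma kernel_spanned_by_nonzero:
  fixes L :: "'a::euclidean_space \<Rightarrow> 'b::euclidean_space"
  assumes L: "linear L" "surj L" and dim: "DIM('a) = DIM('b) + 1"
    and a: "L a = 0" "a \<noteq> 0" and b: "L b = 0"
  obtains c where "b = c *\<^sub>R a"
proof -
  define M where "M v = (L v, v \<bullet> a)" for v
  have lin: "linear M"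
    unfolding M_def using L(1) by (auto intro!: linearI simp: linear_add linear_cmul inner_add_left)
  have "surj M"
    unfolding surj_def
  proof
    fix y :: "'b \<times> real"
    define v where "v = inv L (fst y)"
    have "M (v + ((snd y - v \<bullet> a) / (a \<bullet> a)) *\<^sub>R a) = y"
      using L a by (simp add: M_def v_def linear_add linear_cmul surj_f_inv_f inner_add_left prod_eq_iff)
    then show "\<exists>x. y = M x" by metis
  qed
  then have "inj M"
    using linear_surjective_imp_injective[OF lin] dim by simp
  moreover have "M (b - ((b \<bullet> a) / (a \<bullet> a)) *\<^sub>R a) = 0"
    using L a b by (simp add: M_def linear_diff linear_cmul inner_diff_left zero_prod_def)
  moreover have "M 0 = 0" using lin by (rule linear_0)
  ultimately have "b - ((b \<bullet> a) / (a \<bullet> a)) *\<^sub>R a = 0" by (metis injD)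
  then show ?thesis using that by (metis eq_iff_diff_eq_0)
qed

text \<open>
  The family has as many members as the dimension of the space it spans.
\<close>

lemma spanning_family_independent:
  fixes f :: "'m::finite \<Rightarrow> 'v::euclidean_space"
  assumes span: "dim (span (range f \<union> {g})) = DIM('v)" and dim: "DIM('v) = CARD('m) + 1"
    and zero: "(\<Sum>j\<in>UNIV. w $ j *\<^sub>R f j) + c *\<^sub>R g = 0"
  shows "w = 0 \<and> c = 0"
proof -
  define M where "M y = (\<Sum>j\<in>UNIV. fst y $ j *\<^sub>R f j) + snd y *\<^sub>R g" for y :: "(real ^ 'm) \<times> real"
  have lin: "linear M"
    unfolding M_def by (auto intro!: linearI simp: scaleR_add_left sum.distrib scaleR_add_right scaleR_sum_right)
  have "f j = M (axis j 1, 0)" for j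
    by (simp add: M_def axis_def if_distrib[of "\<lambda>x. x *\<^sub>R _"] cong: if_cong)
  moreover have "g = M (0, 1)" by (simp add: M_def)
  ultimately have "range f \<union> {g} \<subseteq> range M" by blast
  then have "span (range f \<union> {g}) \<subseteq> range M"
    using linear_subspace_image[OF lin subspace_UNIV] by (rule span_minimal)
  moreover have "span (range f \<union> {g}) = UNIV"
    using span dim_eq_full by (metis span_span)
  ultimately have "surj M" by blast
  then have "inj M"
    using linear_surjective_imp_injective[OF lin] dim by simp
  moreover have "M (w, c) = 0" "M 0 = 0" using zero linear_0[OF lin] by (simp_all add: M_def)
  ultimately have "(w, c) = 0" by (metis injD)
  then show ?thesis by (simp add: zero_prod_def)
qed

text \<open>
  The coordinate expression of the system near a point: \<open>S\<close> is an open set of coordinates on which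
  the components of \<open>\<psi>\<close> are first integrals of the nowhere vanishing field \<open>f k\<close>.
\<close>

locale first_integrals_chart =
  fixes S :: "(real ^ 'n::finite) set" and f\<^sub>0 :: "real ^ 'n \<Rightarrow> real ^ 'n"
    and f :: "'m::finite \<Rightarrow> real ^ 'n \<Rightarrow> real ^ 'n" and k :: 'm
    and \<psi> :: "real ^ 'n \<Rightarrow> real ^ 'm"
  assumes open_S: "open S" and smooth_f0: "smooth_on S f\<^sub>0" and smooth_f: "smooth_on S (f j)"
    and smooth_\<psi>: "smooth_on S \<psi>" and card: "CARD('n) = CARD('m) + 1"
    and first_integral: "\<xi> \<in> S \<Longrightarrow> frechet_derivative \<psi> (at \<xi>) (f k \<xi>) = 0"
    and nonzero: "\<xi> \<in> S \<Longrightarrow> f k \<xi> \<noteq> 0"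
begin

definition g :: "real ^ 'n \<Rightarrow> real ^ 'm \<Rightarrow> real ^ 'n" where
  "g \<xi> u = f\<^sub>0 \<xi> + (\<Sum>j\<in>UNIV. u $ j *\<^sub>R f j \<xi>)"

text \<open>
  The time derivative \<open>z'\<close> of \<open>z = \<psi>(x)\<close> along the system.
\<close>

definition z1 :: "real ^ 'n \<Rightarrow> real ^ 'm \<Rightarrow> real ^ 'm" where
  "z1 \<xi> u = frechet_derivative \<psi> (at \<xi>) (g \<xi> u)"

text \<open>
  The map \<open>(x, u) \<mapsto> (z, z')\<close>, completed by \<open>u\<^sub>k\<close>, on which \<open>z'\<close> does not depend. The completion makes source
  and target equal in dimension without introducing a type for the remaining controls.
\<close>

definition \<Phi> :: "(real ^ 'n) \<times> (real ^ 'm) \<Rightarrow> (real ^ 'm) \<times> (real ^ 'm) \<times> real" where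
  "\<Phi> p = (\<psi> (fst p), z1 (fst p) (snd p), snd p $ k)"

definition set_k :: "real \<Rightarrow> real ^ 'm \<Rightarrow> real ^ 'm" where
  "set_k s u = (\<chi> j. if j = k then s else u $ j)"

lemma set_k_simps [simp]:
  "set_k s u $ k = s" "set_k s (set_k t u) = set_k s u" "set_k (u $ k) u = u"
  by (simp_all add: set_k_def vec_eq_iff)

lemma set_k_affine: "set_k s u = set_k 0 u + s *\<^sub>R axis k 1"
  by (simp add: set_k_def vec_eq_iff axis_def)

lemma linear_set_k0: "linear (set_k 0)"
  by (rule linearI) (simp_all add: set_k_def vec_eq_iff)

lemma g_set_k: "g \<xi> (set_k s u) = g \<xi> (set_k 0 u) + s *\<^sub>R f k \<xi>"
proof -
  have "(\<Sum>j\<in>UNIV. set_k s u $ j *\<^sub>R f j \<xi>) =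
    (\<Sum>j\<in>UNIV. set_k 0 u $ j *\<^sub>R f j \<xi> + (if j = k then s *\<^sub>R f k \<xi> else 0))"
    by (rule sum.cong) (auto simp: set_k_def)
  then show ?thesis by (simp add: g_def sum.distrib)
qed

lemma g_set_k': "g \<xi> u = g \<xi> (set_k 0 u) + (u $ k) *\<^sub>R f k \<xi>"
  using g_set_k[of \<xi> "u $ k" u] by simp

lemma linear_D\<psi>: "\<xi> \<in> S \<Longrightarrow> linear (frechet_derivative \<psi> (at \<xi>))"
  using smooth_onD(1)[OF smooth_\<psi>] has_derivative_linear by blast

lemma z1_set_k: "\<xi> \<in> S \<Longrightarrow> z1 \<xi> (set_k s u) = z1 \<xi> u"
  unfolding z1_def g_set_k[of \<xi> s] g_set_k'[of \<xi> u]
  by (simp add: linear_add[OF linear_D\<psi>] linear_cmul[OF linear_D\<psi>] first_integral)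

lemma open_SU: "open (S \<times> (UNIV :: (real ^ 'm) set))"
  using open_S by (simp add: open_Times)

lemma smooth_fst: "smooth_on S h \<Longrightarrow> smooth_on (S \<times> (UNIV :: (real ^ 'm) set)) (\<lambda>p. h (fst p))"
  for h :: "real ^ 'n \<Rightarrow> 'b::real_normed_vector"
  by (rule smooth_on_compose[OF open_SU open_S])
    (auto intro: smooth_on_linear[OF open_SU bounded_linear_fst])

lemma smooth_control: "smooth_on (S \<times> (UNIV :: (real ^ 'm) set)) (\<lambda>p. snd p $ j)"
proof -
  have "bounded_linear (\<lambda>p :: (real ^ 'n) \<times> (real ^ 'm). snd p $ j)"
    by (rule bounded_linear_compose[OF bounded_linear_vec_nth bounded_linear_snd])
  from smooth_on_linear[OF open_SU this] show ?thesis .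
qed

lemma smooth_g: "smooth_on (S \<times> UNIV) (\<lambda>p. g (fst p) (snd p))"
  unfolding g_def
  by (intro smooth_on_add smooth_on_sum smooth_on_scaleR open_SU smooth_fst smooth_f0 smooth_f smooth_control)

lemma smooth_z1: "smooth_on (S \<times> UNIV) (\<lambda>p. z1 (fst p) (snd p))"
  unfolding z1_def
  by (rule smooth_on_derivative_along[OF open_S smooth_\<psi> open_SU _ smooth_g])
    (auto intro: smooth_on_linear[OF open_SU bounded_linear_fst])

lemma smooth_\<Phi>: "smooth_on (S \<times> UNIV) \<Phi>"
proof -
  have "smooth_on (S \<times> UNIV) (\<lambda>p. (\<psi> (fst p), z1 (fst p) (snd p), snd p $ k))"
    by (intro smooth_on_Pair open_SU smooth_fst smooth_\<psi> smooth_z1 smooth_control)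
  then show ?thesis by (simp add: \<Phi>_def[abs_def])
qed

lemma derivative_\<Phi>:
  assumes "\<xi> \<in> S"
  shows "frechet_derivative \<Phi> (at (\<xi>, u)) (a, w) = (frechet_derivative \<psi> (at \<xi>) a,
     frechet_derivative (\<lambda>p. z1 (fst p) (snd p)) (at (\<xi>, u)) (a, w), w $ k)"
proof -
  have p: "(\<xi>, u) \<in> S \<times> UNIV" using assms by simp
  have "((\<lambda>p. \<psi> (fst p)) has_derivative (\<lambda>v. frechet_derivative \<psi> (at \<xi>) (fst v))) (at (\<xi>, u))"
    using has_derivative_compose[OF bounded_linear_imp_has_derivative[OF bounded_linear_fst], of \<psi> _ "(\<xi>, u)"]
      smooth_onD(1)[OF smooth_\<psi> assms] by simp
  moreover have "((\<lambda>p. snd p $ k) has_derivative (\<lambda>v. snd v $ k)) (at (\<xi>, u))"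
    by (rule bounded_linear_imp_has_derivative[OF bounded_linear_compose[OF bounded_linear_vec_nth bounded_linear_snd]])
  ultimately have "((\<lambda>p. (\<psi> (fst p), z1 (fst p) (snd p), snd p $ k)) has_derivative
    (\<lambda>v. (frechet_derivative \<psi> (at \<xi>) (fst v),
     frechet_derivative (\<lambda>p. z1 (fst p) (snd p)) (at (\<xi>, u)) v, snd v $ k))) (at (\<xi>, u))"
    by (intro has_derivative_Pair smooth_onD(1)[OF smooth_z1 p])
  from frechet_derivative_at[OF this] show ?thesis by (simp add: \<Phi>_def[abs_def] fun_eq_iff)
qed

lemma derivative_z1_control:
  assumes "\<xi> \<in> S"
  shows "frechet_derivative (\<lambda>p. z1 (fst p) (snd p)) (at (\<xi>, u)) (0, w) =
    frechet_derivative \<psi> (at \<xi>) (\<Sum>j\<in>UNIV. w $ j *\<^sub>R f j \<xi>)"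
proof -
  have "((\<lambda>t. z1 (fst ((\<xi>, u) + t *\<^sub>R (0, w))) (snd ((\<xi>, u) + t *\<^sub>R (0, w)))) has_vector_derivative
     frechet_derivative (\<lambda>p. z1 (fst p) (snd p)) (at (\<xi>, u)) (0, w)) (at 0)"
    by (rule has_vector_derivative_compose[where \<gamma>="\<lambda>t. (\<xi>, u) + t *\<^sub>R (0, w)"])
      (use assms smooth_onD(1)[OF smooth_z1, of "(\<xi>, u)"] in \<open>auto intro!: derivative_eq_intros\<close>)
  moreover have "z1 (fst ((\<xi>, u) + t *\<^sub>R (0, w))) (snd ((\<xi>, u) + t *\<^sub>R (0, w))) =
    z1 \<xi> u + t *\<^sub>R frechet_derivative \<psi> (at \<xi>) (\<Sum>j\<in>UNIV. w $ j *\<^sub>R f j \<xi>)" for t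
  proof -
    have "g \<xi> (u + t *\<^sub>R w) = g \<xi> u + t *\<^sub>R (\<Sum>j\<in>UNIV. w $ j *\<^sub>R f j \<xi>)"
      by (simp add: g_def scaleR_add_left sum.distrib scaleR_sum_right)
    then show ?thesis by (simp add: z1_def linear_add[OF linear_D\<psi>[OF assms]] linear_cmul[OF linear_D\<psi>[OF assms]])
  qed
  ultimately have "((\<lambda>t. z1 \<xi> u + t *\<^sub>R frechet_derivative \<psi> (at \<xi>) (\<Sum>j\<in>UNIV. w $ j *\<^sub>R f j \<xi>)) has_vector_derivative
     frechet_derivative (\<lambda>p. z1 (fst p) (snd p)) (at (\<xi>, u)) (0, w)) (at 0)" by simp
  moreover have "((\<lambda>t. z1 \<xi> u + t *\<^sub>R frechet_derivative \<psi> (at \<xi>) (\<Sum>j\<in>UNIV. w $ j *\<^sub>R f j \<xi>)) has_vector_derivative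
     frechet_derivative \<psi> (at \<xi>) (\<Sum>j\<in>UNIV. w $ j *\<^sub>R f j \<xi>)) (at 0)"
    by (auto intro!: derivative_eq_intros)
  ultimately show ?thesis by (rule vector_derivative_unique_at)
qed

lemma smooth_g_fixed_control: "smooth_on S (\<lambda>\<xi>. g \<xi> u)"
  unfolding g_def
  by (intro smooth_on_add smooth_on_sum smooth_on_scaleR open_S smooth_f0 smooth_f smooth_on_const)

text \<open>
  This is where the bracket comes in. The Lie derivative of \<open>\<psi>\<close> along \<open>f\<^sub>k\<close> vanishes near the point,
  so of the two terms of the commutator only the derivative of \<open>z'\<close> along \<open>f\<^sub>k\<close> is left.
\<close>

lemma derivative_z1_along_fk:
  assumes "\<xi> \<in> S"
  shows "frechet_derivative (\<lambda>p. z1 (fst p) (snd p)) (at (\<xi>, u)) (f k \<xi>, 0) =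
    - frechet_derivative \<psi> (at \<xi>) (lie_bracket (\<lambda>\<xi>. g \<xi> u) (f k) \<xi>)"
proof -
  have "((\<lambda>y. z1 y u) has_derivative (\<lambda>a. frechet_derivative (\<lambda>p. z1 (fst p) (snd p)) (at (\<xi>, u)) (a, 0))) (at \<xi>)"
  proof -
    have "((\<lambda>y. (y, u)) has_derivative (\<lambda>a. (a, 0))) (at \<xi>)"
      by (intro has_derivative_Pair has_derivative_ident has_derivative_const)
    from has_derivative_compose[OF this, of "\<lambda>p. z1 (fst p) (snd p)"] show ?thesis
      using smooth_onD(1)[OF smooth_z1, of "(\<xi>, u)"] assms by simp
  qed
  from fun_cong[OF frechet_derivative_at[OF this], of "f k \<xi>"]
  have "frechet_derivative (\<lambda>p. z1 (fst p) (snd p)) (at (\<xi>, u)) (f k \<xi>, 0) =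
    frechet_derivative (\<lambda>y. frechet_derivative \<psi> (at y) (g y u)) (at \<xi>) (f k \<xi>)"
    unfolding z1_def .
  moreover have "frechet_derivative (\<lambda>y. frechet_derivative \<psi> (at y) (f k y)) (at \<xi>) = (\<lambda>v. 0)"
  proof -
    have "frechet_derivative (\<lambda>y. frechet_derivative \<psi> (at y) (f k y)) (at \<xi>) =
       frechet_derivative (\<lambda>y. 0) (at \<xi>)"
      by (rule frechet_derivative_cong[OF open_S assms]) (rule first_integral)
    then show ?thesis by simp
  qed
  ultimately show ?thesis
    unfolding lie_derivative_commutator[OF open_S assms smooth_\<psi> smooth_g_fixed_control[of u] smooth_f[of k], symmetric]
    by simp
qed

lemma kernel_D\<psi>:
  assumes "\<xi> \<in> S" "surj (frechet_derivative \<psi> (at \<xi>))" "frechet_derivative \<psi> (at \<xi>) a = 0"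
  obtains c where "a = c *\<^sub>R f k \<xi>"
  using kernel_spanned_by_nonzero[OF linear_D\<psi>[OF assms(1)] assms(2) _ first_integral[OF assms(1)] nonzero[OF assms(1)] assms(3)]
    card by auto

text \<open>
  A vector \<open>(a, w)\<close> in the kernel has \<open>a = c f\<^sub>k\<close> and \<open>w\<^sub>k = 0\<close>; the \<open>z'\<close>-component then says that
  \<open>\<Sum>j. w\<^sub>j f\<^sub>j - c [g, f\<^sub>k]\<close> is killed by \<open>d\<psi>\<close>, so it is a multiple \<open>d f\<^sub>k\<close>. Independence of
  the \<open>f\<^sub>j\<close> and the bracket gives \<open>c = 0\<close> and \<open>w = d e\<^sub>k\<close>, and \<open>w\<^sub>k = 0\<close> finally gives \<open>w = 0\<close>.
\<close>

lemma inj_derivative_\<Phi>: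
  assumes \<xi>: "\<xi> \<in> S" and surj: "surj (frechet_derivative \<psi> (at \<xi>))"
    and span: "dim (span (range (\<lambda>j. f j \<xi>) \<union> {lie_bracket (\<lambda>\<xi>. g \<xi> u) (f k) \<xi>})) = CARD('n)"
  shows "inj (frechet_derivative \<Phi> (at (\<xi>, u)))"
proof -
  let ?D = "frechet_derivative \<psi> (at \<xi>)" and ?D1 = "frechet_derivative (\<lambda>p. z1 (fst p) (snd p)) (at (\<xi>, u))"
  let ?br = "lie_bracket (\<lambda>\<xi>. g \<xi> u) (f k) \<xi>"
  have p: "(\<xi>, u) \<in> S \<times> UNIV" using \<xi> by simp
  have lin: "linear (frechet_derivative \<Phi> (at (\<xi>, u)))" "linear ?D1"
    using smooth_onD(1)[OF smooth_\<Phi> p] smooth_onD(1)[OF smooth_z1 p] has_derivative_linear by blast+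
  have "(a, w) = 0" if 0: "frechet_derivative \<Phi> (at (\<xi>, u)) (a, w) = 0" for a w
  proof -
    have zero: "?D a = 0" "?D1 (a, w) = 0" "w $ k = 0"
      using 0 derivative_\<Phi>[OF \<xi>] by (simp_all add: zero_prod_def)
    obtain c where c: "a = c *\<^sub>R f k \<xi>" using kernel_D\<psi>[OF \<xi> surj zero(1)] .
    have "(a, w) = c *\<^sub>R (f k \<xi>, 0) + (0, w)" by (simp add: c)
    then have "?D1 (a, w) = c *\<^sub>R ?D1 (f k \<xi>, 0) + ?D1 (0, w)"
      by (simp only: linear_add[OF lin(2)] linear_cmul[OF lin(2)])
    also have "\<dots> = ?D ((\<Sum>j\<in>UNIV. w $ j *\<^sub>R f j \<xi>) - c *\<^sub>R ?br)"
      by (simp add: derivative_z1_along_fk[OF \<xi>] derivative_z1_control[OF \<xi>] linear_diff[OF linear_D\<psi>[OF \<xi>]]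
          linear_cmul[OF linear_D\<psi>[OF \<xi>]])
    finally have "?D ((\<Sum>j\<in>UNIV. w $ j *\<^sub>R f j \<xi>) - c *\<^sub>R ?br) = 0" using zero(2) by simp
    then obtain d where d: "(\<Sum>j\<in>UNIV. w $ j *\<^sub>R f j \<xi>) - c *\<^sub>R ?br = d *\<^sub>R f k \<xi>"
      using kernel_D\<psi>[OF \<xi> surj] by blast
    \<comment> \<open>Collect the multiple of \<open>f\<^sub>k\<close> in the coefficients of the family \<open>f\<^sub>j\<close>.\<close>
    have "(\<Sum>j\<in>UNIV. (w - d *\<^sub>R axis k 1) $ j *\<^sub>R f j \<xi>) = (\<Sum>j\<in>UNIV. w $ j *\<^sub>R f j \<xi> - (if j = k then d *\<^sub>R f k \<xi> else 0))"
      by (rule sum.cong) (auto simp: axis_def scaleR_diff_left)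
    then have "(\<Sum>j\<in>UNIV. (w - d *\<^sub>R axis k 1) $ j *\<^sub>R f j \<xi>) + (- c) *\<^sub>R ?br = 0"
      using d by (simp add: sum_subtractf algebra_simps)
    from spanning_family_independent[OF _ _ this] span card
    have "w - d *\<^sub>R axis k 1 = 0" "c = 0" by auto
    moreover from this(1) have "w $ k = d" by simp
    ultimately show ?thesis using zero(3) c by (simp add: zero_prod_def)
  qed
  then have "\<forall>v. frechet_derivative \<Phi> (at (\<xi>, u)) v = 0 \<longrightarrow> v = 0" by auto
  then show ?thesis using linear_injective_0[OF lin(1)] by blast
qed

end

section \<open>The inverse of the prolongation\<close>

lemma continuous_on_line_fun:
  fixes p v :: "nat \<Rightarrow> 'c::real_normed_vector"
  shows "continuous_on UNIV (\<lambda>t. p + t *\<^sub>R v)"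
  by (rule continuous_on_coordinatewise_then_product)
    (auto simp: scaleR_fun_def intro!: continuous_intros)

lemma jet_space_state:
  fixes S :: "'v::euclidean_space set" and P :: "('v \<times> (nat \<Rightarrow> 'c::euclidean_space)) set"
  assumes "open S" "open P" "P \<subseteq> S \<times> UNIV"
  shows "jet_space fst (\<lambda>j p. snd p j) state_coords S P"
proof (rule jet_space.intro)
  show "linear (fst :: 'v \<times> (nat \<Rightarrow> 'c) \<Rightarrow> 'v)" by (rule linearI) simp_all
  show "linear (\<lambda>p :: 'v \<times> (nat \<Rightarrow> 'c). snd p j)" for j
    by (rule linearI) (simp_all add: scaleR_fun_def)
  show "continuous_on UNIV (fst :: 'v \<times> (nat \<Rightarrow> 'c) \<Rightarrow> 'v)" by (intro continuous_intros)
  show "continuous_on UNIV (\<lambda>p :: 'v \<times> (nat \<Rightarrow> 'c). snd p j)" for j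
    by (rule continuous_on_product_then_coordinatewise) (intro continuous_intros)
  show "continuous_on UNIV (\<lambda>t. p + t *\<^sub>R v)" for p v :: "'v \<times> (nat \<Rightarrow> 'c)"
  proof -
    have "continuous_on UNIV (\<lambda>t. (fst p + t *\<^sub>R fst v, snd p + t *\<^sub>R snd v))"
      by (intro continuous_on_Pair continuous_on_line_fun continuous_intros)
    then show ?thesis by (simp add: plus_prod_def scaleR_prod_def)
  qed
  show "fst p = fst q \<and> (\<forall>j\<le>N. snd p j = snd q j)"
    if "1 \<le> N" "state_coords N p = state_coords N q" for N and p q :: "'v \<times> (nat \<Rightarrow> 'c)"
    using that(2) by (auto simp: state_coords_def out_coords_def map_eq_conv simp del: upt_Suc)
qed (use assms in auto)

lemma jet_space_output:
  fixes S :: "('c::euclidean_space \<times> 'c) set" and P :: "(nat \<Rightarrow> 'c) set"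
  assumes "open S" "open P" "\<And>\<zeta>. \<zeta> \<in> P \<Longrightarrow> (\<zeta> 0, \<zeta> (Suc 0)) \<in> S"
  shows "jet_space (\<lambda>\<zeta>. (\<zeta> 0, \<zeta> (Suc 0))) (\<lambda>j \<zeta>. \<zeta> j) out_coords S P"
proof (rule jet_space.intro)
  show "linear (\<lambda>\<zeta> :: nat \<Rightarrow> 'c. (\<zeta> 0, \<zeta> (Suc 0)))" "linear (\<lambda>\<zeta> :: nat \<Rightarrow> 'c. \<zeta> j)" for j
    by (rule linearI; simp add: scaleR_fun_def)+
  show "continuous_on UNIV (\<lambda>\<zeta> :: nat \<Rightarrow> 'c. (\<zeta> 0, \<zeta> (Suc 0)))" "continuous_on UNIV (\<lambda>\<zeta> :: nat \<Rightarrow> 'c. \<zeta> j)" for j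
    by (auto intro!: continuous_on_Pair)
  show "continuous_on UNIV (\<lambda>t. p + t *\<^sub>R v)" for p v :: "nat \<Rightarrow> 'c"
    by (rule continuous_on_line_fun)
  show "(p 0, p (Suc 0)) = (q 0, q (Suc 0)) \<and> (\<forall>j\<le>N. p j = q j)"
    if "1 \<le> N" "out_coords N p = out_coords N q" for N and p q :: "nat \<Rightarrow> 'c"
    using that by (auto simp: out_coords_def map_eq_conv simp del: upt_Suc)
qed (use assms in auto)

text \<open>
  The outcome of the inverse function theorem for \<open>\<Phi>\<close>. The number \<open>s\<close> is a reference value for the
  control \<open>u\<^sub>k\<close>: since \<open>z'\<close> does not depend on \<open>u\<^sub>k\<close>, only the slice \<open>u\<^sub>k = s\<close> of the inverse \<open>\<Theta>\<close>
  is used.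
\<close>

locale local_first_jet_inverse = first_integrals_chart S f\<^sub>0 f k \<psi>
  for S :: "(real ^ 'n::finite) set" and f\<^sub>0 :: "real ^ 'n \<Rightarrow> real ^ 'n"
    and f :: "'m::finite \<Rightarrow> real ^ 'n \<Rightarrow> real ^ 'n" and k :: 'm
    and \<psi> :: "real ^ 'n \<Rightarrow> real ^ 'm" +
  fixes D :: "((real ^ 'n) \<times> (real ^ 'm)) set" and V :: "((real ^ 'm) \<times> (real ^ 'm) \<times> real) set"
    and \<Theta> :: "(real ^ 'm) \<times> (real ^ 'm) \<times> real \<Rightarrow> (real ^ 'n) \<times> (real ^ 'm)" and s :: real
  assumes open_D: "open D" and D_S: "D \<subseteq> S \<times> UNIV" and open_V: "open V"
    and hom: "homeomorphism D V \<Phi> \<Theta>" and smooth_\<Theta>: "smooth_on V \<Theta>"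
    and bij_D\<Phi>: "p \<in> D \<Longrightarrow> bij (frechet_derivative \<Phi> (at p))"
begin

text \<open>
  No condition is imposed on \<open>u\<^sub>k\<close> or on the derivatives of \<open>u\<close>, and none on \<open>z''\<close> and higher
  derivatives in \<open>Q\<close>. In this way the sets are open for the product topology and correspond
  to each other exactly.
\<close>

definition P :: "((real ^ 'n) \<times> (nat \<Rightarrow> real ^ 'm)) set" where
  "P = {p. (fst p, set_k s (snd p 0)) \<in> D}"

definition V\<^sub>s :: "((real ^ 'm) \<times> (real ^ 'm)) set" where
  "V\<^sub>s = {y. (fst y, snd y, s) \<in> V}"

definition Q :: "(nat \<Rightarrow> real ^ 'm) set" where
  "Q = {\<zeta>. (\<zeta> 0, \<zeta> (Suc 0)) \<in> V\<^sub>s}"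

definition X :: "(real ^ 'm) \<times> (real ^ 'm) \<Rightarrow> real ^ 'n" where
  "X y = fst (\<Theta> (fst y, snd y, s))"

definition U' :: "(real ^ 'm) \<times> (real ^ 'm) \<Rightarrow> real ^ 'm" where
  "U' y = snd (\<Theta> (fst y, snd y, s))"

lemma open_P: "open P"
proof -
  have "continuous_on UNIV (\<lambda>p :: (real ^ 'n) \<times> (nat \<Rightarrow> real ^ 'm). snd p 0)"
    by (rule continuous_on_product_then_coordinatewise) (intro continuous_intros)
  from continuous_on_compose2[OF linear_continuous_on[OF linear_set_k0[unfolded linear_conv_bounded_linear], of UNIV] this subset_UNIV]
  have "continuous_on UNIV (\<lambda>p :: (real ^ 'n) \<times> (nat \<Rightarrow> real ^ 'm). (fst p, set_k s (snd p 0)))"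
    unfolding set_k_affine[of s] by (intro continuous_on_Pair continuous_on_add continuous_on_const continuous_on_fst continuous_on_id)
  from open_vimage[OF open_D this] show ?thesis by (simp add: P_def vimage_def)
qed

lemma open_Vs: "open V\<^sub>s"
proof -
  have "open ((\<lambda>y. (fst y, snd y, s)) -` V)"
    by (rule open_vimage[OF open_V]) (intro continuous_intros)
  then show ?thesis by (simp add: V\<^sub>s_def vimage_def)
qed

lemma open_Q: "open Q"
proof -
  have "open ((\<lambda>\<zeta>. (\<zeta> 0, \<zeta> (Suc 0))) -` V\<^sub>s)"
    by (rule open_vimage[OF open_Vs]) (auto intro!: continuous_on_Pair)
  then show ?thesis by (simp add: Q_def vimage_def)
qed

lemma P_S: "P \<subseteq> S \<times> UNIV"
  using D_S by (auto simp: P_def)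

sublocale state: jet_space fst "\<lambda>j p. snd p j" state_coords S P
  by (rule jet_space_state[OF open_S open_P P_S])

sublocale outputs: jet_space "\<lambda>\<zeta>. (\<zeta> 0, \<zeta> (Suc 0))" "\<lambda>j \<zeta>. \<zeta> j" out_coords V\<^sub>s Q
  by (rule jet_space_output[OF open_Vs open_Q]) (simp add: Q_def)

lemma smooth_section: "smooth_on V\<^sub>s (\<lambda>y. \<Theta> (fst y, snd y, s))"
proof (rule smooth_on_compose[OF open_Vs open_V _ _ smooth_\<Theta>])
  show "(fst y, snd y, s) \<in> V" if "y \<in> V\<^sub>s" for y using that by (simp add: V\<^sub>s_def)
  show "smooth_on V\<^sub>s (\<lambda>y. (fst y, snd y, s))"
    by (intro smooth_on_Pair smooth_on_const smooth_on_linear[OF open_Vs bounded_linear_fst]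
        smooth_on_linear[OF open_Vs bounded_linear_snd] open_Vs)
qed

lemma smooth_X: "smooth_on V\<^sub>s X" and smooth_U': "smooth_on V\<^sub>s U'"
  unfolding X_def U'_def
  by (rule smooth_on_bounded_linear[OF open_Vs _ smooth_section], rule bounded_linear_fst bounded_linear_snd)+

lemma section_inverse:
  assumes "y \<in> V\<^sub>s"
  shows "(X y, U' y) \<in> D" "\<psi> (X y) = fst y" "z1 (X y) (U' y) = snd y" "U' y $ k = s" "X y \<in> S"
proof -
  have "(fst y, snd y, s) \<in> V" using assms by (simp add: V\<^sub>s_def)
  with hom have "\<Theta> (fst y, snd y, s) \<in> D" "\<Phi> (\<Theta> (fst y, snd y, s)) = (fst y, snd y, s)"
    by (auto simp: homeomorphism_def)
  then show "(X y, U' y) \<in> D" "\<psi> (X y) = fst y" "z1 (X y) (U' y) = snd y" "U' y $ k = s" "X y \<in> S"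
    using D_S by (auto simp: X_def U'_def \<Phi>_def)
qed

lemma section_of_first_jet:
  assumes "p \<in> P"
  shows "(\<psi> (fst p), z1 (fst p) (snd p 0)) \<in> V\<^sub>s"
    and "X (\<psi> (fst p), z1 (fst p) (snd p 0)) = fst p"
    and "U' (\<psi> (fst p), z1 (fst p) (snd p 0)) = set_k s (snd p 0)"
proof -
  have p: "(fst p, set_k s (snd p 0)) \<in> D" "fst p \<in> S" using assms P_S by (auto simp: P_def)
  have "\<Phi> (fst p, set_k s (snd p 0)) = (\<psi> (fst p), z1 (fst p) (snd p 0), s)"
    using p by (simp add: \<Phi>_def z1_set_k)
  moreover have "\<Phi> (fst p, set_k s (snd p 0)) \<in> V" "\<Theta> (\<Phi> (fst p, set_k s (snd p 0))) = (fst p, set_k s (snd p 0))"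
    using hom p(1) by (auto simp: homeomorphism_def)
  ultimately show "(\<psi> (fst p), z1 (fst p) (snd p 0)) \<in> V\<^sub>s"
    "X (\<psi> (fst p), z1 (fst p) (snd p 0)) = fst p"
    "U' (\<psi> (fst p), z1 (fst p) (snd p 0)) = set_k s (snd p 0)"
    by (simp_all add: V\<^sub>s_def X_def U'_def)
qed

lemma surj_D\<psi>:
  assumes "(\<xi>, u) \<in> D"
  shows "surj (frechet_derivative \<psi> (at \<xi>))"
proof -
  have \<xi>: "\<xi> \<in> S" using assms D_S by auto
  have "\<exists>a. frechet_derivative \<psi> (at \<xi>) a = y" for y
  proof -
    obtain a w where "frechet_derivative \<Phi> (at (\<xi>, u)) (a, w) = (y, 0, 0)"
      using bij_D\<Phi>[OF assms] by (metis bij_pointE surj_pair)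
    then show ?thesis using derivative_\<Phi>[OF \<xi>] by auto
  qed
  then show ?thesis by (metis surjI)
qed

definition Z :: "(real ^ 'n) \<times> (nat \<Rightarrow> real ^ 'm) \<Rightarrow> nat \<Rightarrow> real ^ 'm" where
  "Z = prolongation g (\<lambda>p. \<psi> (fst p))"

lemma Z_0: "Z p 0 = \<psi> (fst p)"
  by (simp add: Z_def prolongation_def)

lemma Z_Suc: "Z p (Suc j) = cartan_deriv g (\<lambda>q. Z q j) p"
  by (simp add: Z_def prolongation_def)

lemma jet_fun_g: "state.jet_fun (\<lambda>p. g (fst p) (snd p 0))"
proof -
  have "linear (\<lambda>u :: real ^ 'm. u $ j)" for j
    by (rule bounded_linear.linear[OF bounded_linear_vec_nth])
  then show ?thesis
    unfolding g_def
    by (intro state.jet_fun_add state.jet_fun_sum state.jet_fun_scaleR state.jet_fun_base smooth_f0 smooth_f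
        state.jet_fun_linear[OF state.jet_fun_coord])
qed

lemma jet_field_cartan: "state.jet_field (cartan_field g)"
  using jet_fun_g state.jet_fun_coord by (simp add: state.jet_field_def cartan_field_def)

lemma jet_fun_Z: "state.jet_fun (\<lambda>p. Z p j)"
proof (induction j)
  case 0
  then show ?case using state.jet_fun_base[OF smooth_\<psi>] by (simp add: Z_0)
next
  case (Suc j)
  then show ?case
    using state.jet_fun_dir_deriv[OF Suc jet_field_cartan] by (simp add: Z_Suc cartan_deriv_def)
qed

lemma Z_1:
  assumes "p \<in> P"
  shows "Z p (Suc 0) = z1 (fst p) (snd p 0)"
  using Z_Suc[of p 0] state.dir_deriv_base[OF assms smooth_\<psi>]
  by (simp add: Z_0 cartan_deriv_def cartan_field_def z1_def)

lemma Z_Q: "p \<in> P \<Longrightarrow> Z p \<in> Q"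
  using section_of_first_jet(1) Z_1 by (simp add: Q_def Z_0)

definition shift :: "(nat \<Rightarrow> real ^ 'm) \<Rightarrow> nat \<Rightarrow> real ^ 'm" where
  "shift \<zeta> = (\<lambda>j. \<zeta> (Suc j))"

text \<open>
  Differentiation along the trivial Cartan field.
\<close>

definition \<tau> :: "((nat \<Rightarrow> real ^ 'm) \<Rightarrow> 'b::euclidean_space) \<Rightarrow> (nat \<Rightarrow> real ^ 'm) \<Rightarrow> 'b" where
  "\<tau> F \<zeta> = dir_deriv F \<zeta> (shift \<zeta>)"

lemma jet_field_shift: "outputs.jet_field shift"
  unfolding outputs.jet_field_def shift_def
  by (intro conjI allI outputs.jet_fun_Pair outputs.jet_fun_coord)

lemma jet_fun_\<tau>: "outputs.jet_fun F \<Longrightarrow> outputs.jet_fun (\<tau> F)"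
  unfolding \<tau>_def using outputs.jet_fun_dir_deriv[OF _ jet_field_shift] by blast

text \<open>
  By construction, \<open>Z\<close> sends the direction of the Cartan field of the system at \<open>p\<close> to the shift
  direction at \<open>Z p\<close>; this is the chain rule along the image of a straight line.
\<close>

lemma cartan_deriv_pullback:
  assumes "outputs.jet_fun F" "p \<in> P"
  shows "cartan_deriv g (\<lambda>q. F (Z q)) p = \<tau> F (Z p)"
proof -
  let ?l = "\<lambda>t. p + t *\<^sub>R cartan_field g p"
  note l = state.tangent_line[OF assms(2), of "cartan_field g p"]
  have d: "((\<lambda>t. Z (?l t) j) has_vector_derivative shift (Z p) j) (at 0)" for j
    using state.dir_deriv_along_curve[OF jet_fun_Z l] by (simp add: shift_def Z_Suc cartan_deriv_def)
  have "outputs.tangent (\<lambda>t. Z (?l t)) (Z p) (shift (Z p))"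
    unfolding outputs.tangent_def
  proof (intro conjI allI)
    show "Z p \<in> Q" using Z_Q assms(2) .
    show "Z (p + 0 *\<^sub>R cartan_field g p) = Z p" by simp
    show "eventually (\<lambda>t. Z (?l t) \<in> Q) (nhds 0)"
    proof -
      have "eventually (\<lambda>t. ?l t \<in> P) (nhds 0)" using l unfolding state.tangent_def by blast
      then show ?thesis by (rule eventually_mono) (rule Z_Q)
    qed
    show "((\<lambda>t. (Z (?l t) 0, Z (?l t) (Suc 0))) has_vector_derivative (shift (Z p) 0, shift (Z p) (Suc 0))) (at 0)"
      by (intro has_vector_derivative_Pair d)
  qed (rule d)
  from outputs.dir_deriv_along_curve[OF assms(1) this] show ?thesis
    unfolding cartan_deriv_def \<tau>_def by (rule dir_deriv_eqI)
qed

definition \<X> :: "(nat \<Rightarrow> real ^ 'm) \<Rightarrow> real ^ 'n" where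
  "\<X> \<zeta> = X (\<zeta> 0, \<zeta> (Suc 0))"

definition \<U> :: "(nat \<Rightarrow> real ^ 'm) \<Rightarrow> real ^ 'm" where
  "\<U> \<zeta> = U' (\<zeta> 0, \<zeta> (Suc 0))"

text \<open>
  The factor of \<open>f\<^sub>k\<close> in \<open>x' - f\<^sub>0 - \<Sum>j\<noteq>k. u\<^sub>j f\<^sub>j\<close>, read off by taking the inner product with \<open>f\<^sub>k\<close>.
\<close>

definition u\<^sub>k :: "(nat \<Rightarrow> real ^ 'm) \<Rightarrow> real" where
  "u\<^sub>k \<zeta> = inverse (f k (\<X> \<zeta>) \<bullet> f k (\<X> \<zeta>)) *\<^sub>R (f k (\<X> \<zeta>) \<bullet> (\<tau> \<X> \<zeta> - g (\<X> \<zeta>) (set_k 0 (\<U> \<zeta>))))"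

definition control :: "(nat \<Rightarrow> real ^ 'm) \<Rightarrow> real ^ 'm" where
  "control \<zeta> = set_k (u\<^sub>k \<zeta>) (\<U> \<zeta>)"

definition \<Psi> :: "(nat \<Rightarrow> real ^ 'm) \<Rightarrow> (real ^ 'n) \<times> (nat \<Rightarrow> real ^ 'm)" where
  "\<Psi> \<zeta> = (\<X> \<zeta>, \<lambda>j. (\<tau> ^^ j) control \<zeta>)"

lemma u\<^sub>k_eqI:
  assumes "\<X> \<zeta> \<in> S" "\<tau> \<X> \<zeta> = g (\<X> \<zeta>) (set_k c (\<U> \<zeta>))"
  shows "u\<^sub>k \<zeta> = c"
proof -
  have "\<tau> \<X> \<zeta> - g (\<X> \<zeta>) (set_k 0 (\<U> \<zeta>)) = c *\<^sub>R f k (\<X> \<zeta>)"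
    unfolding assms(2) g_set_k[of _ c] by simp
  then show ?thesis using nonzero[OF assms(1)] by (simp add: u\<^sub>k_def)
qed

lemma jet_fun_\<X>: "outputs.jet_fun \<X>" and jet_fun_\<U>: "outputs.jet_fun \<U>"
  unfolding \<X>_def \<U>_def by (rule outputs.jet_fun_base[OF smooth_X] outputs.jet_fun_base[OF smooth_U'])+

lemma jet_fun_state_field:
  assumes "smooth_on S h"
  shows "outputs.jet_fun (\<lambda>\<zeta>. h (\<X> \<zeta>))"
  unfolding \<X>_def
  by (rule outputs.jet_fun_base, rule smooth_on_compose[OF open_Vs open_S section_inverse(5) smooth_X assms])

lemma jet_fun_u\<^sub>k: "outputs.jet_fun u\<^sub>k"
proof -
  have 1: "smooth_on S (\<lambda>\<xi>. inverse (f k \<xi> \<bullet> f k \<xi>))"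
  proof (rule smooth_on_inverse[OF open_S])
    show "smooth_on S (\<lambda>\<xi>. f k \<xi> \<bullet> f k \<xi>)"
    proof (rule smooth_on_cong[OF open_S])
      show "(\<Sum>b\<in>Basis. (f k \<xi> \<bullet> b) *\<^sub>R (f k \<xi> \<bullet> b)) = f k \<xi> \<bullet> f k \<xi>" for \<xi>
        using euclidean_inner[of "f k \<xi>" "f k \<xi>"] by simp
      show "smooth_on S (\<lambda>\<xi>. \<Sum>b\<in>Basis. (f k \<xi> \<bullet> b) *\<^sub>R (f k \<xi> \<bullet> b))"
        by (intro smooth_on_sum smooth_on_scaleR smooth_on_bounded_linear[OF _ bounded_linear_inner_left] open_S smooth_f)
    qed
  qed (simp add: nonzero)
  have lin: "linear (\<lambda>u :: real ^ 'm. set_k 0 u $ j)" for j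
    using linear_compose[OF linear_set_k0 bounded_linear.linear[OF bounded_linear_vec_nth]] by (simp add: o_def)
  have 2: "outputs.jet_fun (\<lambda>\<zeta>. g (\<X> \<zeta>) (set_k 0 (\<U> \<zeta>)))"
    unfolding g_def
    by (intro outputs.jet_fun_add outputs.jet_fun_sum outputs.jet_fun_scaleR jet_fun_state_field smooth_f0 smooth_f
        outputs.jet_fun_linear[OF jet_fun_\<U> lin])
  have "outputs.jet_fun (\<lambda>\<zeta>. \<tau> \<X> \<zeta> + (- 1) *\<^sub>R g (\<X> \<zeta>) (set_k 0 (\<U> \<zeta>)))"
    by (intro outputs.jet_fun_add outputs.jet_fun_scaleR outputs.jet_fun_const 2 jet_fun_\<tau>[OF jet_fun_\<X>])
  then show ?thesis
    unfolding u\<^sub>k_def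
    by (intro outputs.jet_fun_scaleR jet_fun_state_field 1 outputs.jet_fun_inner smooth_f) simp
qed

lemma jet_fun_control: "outputs.jet_fun control"
  unfolding control_def set_k_affine[of "u\<^sub>k _"]
  by (intro outputs.jet_fun_add outputs.jet_fun_scaleR outputs.jet_fun_const jet_fun_u\<^sub>k outputs.jet_fun_linear[OF jet_fun_\<U> linear_set_k0])

lemma jet_fun_control_derivatives: "outputs.jet_fun ((\<tau> ^^ j) control)"
proof (induction j)
  case 0
  then show ?case using jet_fun_control by simp
next
  case (Suc j)
  then show ?case using jet_fun_\<tau>[OF Suc] by simp
qed

text \<open>
  \<open>\<X>\<close> pulls back along \<open>Z\<close> to the state. Differentiating this identity shows that \<open>\<tau> \<X>\<close> pulls back to
  \<open>g(x, u)\<close>, so that \<open>u\<^sub>k\<close> is recovered; differentiating repeatedly recovers the derivatives of \<open>u\<close>.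
\<close>

lemma \<Psi>_Z:
  assumes "p \<in> P"
  shows "\<Psi> (Z p) = p"
proof -
  have X: "\<X> (Z p) = fst p" and U: "\<U> (Z p) = set_k s (snd p 0)" if "p \<in> P" for p
    using section_of_first_jet[OF that] Z_0 Z_1[OF that] by (simp_all add: \<X>_def \<U>_def)
  have "control (Z p) = snd p 0" if p: "p \<in> P" for p
  proof -
    have "\<tau> \<X> (Z p) = cartan_deriv g fst p"
      unfolding cartan_deriv_pullback[OF jet_fun_\<X> p, symmetric] cartan_deriv_def
      by (rule state.dir_deriv_cong[OF p]) (simp add: X)
    also have "\<dots> = g (fst p) (snd p 0)"
      unfolding cartan_deriv_def
      by (rule dir_deriv_eqI, rule has_vector_derivative_linear_line[OF state.linear_\<pi>, THEN has_vector_derivative_eq_rhs])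
        (simp add: cartan_field_def)
    finally have "u\<^sub>k (Z p) = snd p 0 $ k"
      using p P_S by (intro u\<^sub>k_eqI) (auto simp: X U)
    then show ?thesis by (simp add: control_def U[OF p])
  qed
  then have "(\<tau> ^^ j) control (Z p) = snd p j" if "p \<in> P" for p j
    using that
  proof (induction j arbitrary: p)
    case (Suc j)
    have "(\<tau> ^^ Suc j) control (Z p) = cartan_deriv g (\<lambda>q. (\<tau> ^^ j) control (Z q)) p"
      using cartan_deriv_pullback[OF jet_fun_control_derivatives Suc.prems(2)] by simp
    also have "\<dots> = cartan_deriv g (\<lambda>q. snd q j) p"
      unfolding cartan_deriv_def by (rule state.dir_deriv_cong[OF Suc.prems(2)]) (use Suc in blast)
    also have "\<dots> = snd p (Suc j)"
      unfolding cartan_deriv_def by (simp add: state.dir_deriv_coord cartan_field_def)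
    finally show ?case .
  qed simp
  then show ?thesis using X assms by (simp add: \<Psi>_def prod_eq_iff fun_eq_iff)
qed

lemma \<Psi>_P: "\<zeta> \<in> Q \<Longrightarrow> \<Psi> \<zeta> \<in> P"
  using section_inverse(1,4)[of "(\<zeta> 0, \<zeta> (Suc 0))"] set_k_simps(3)[of "U' (\<zeta> 0, \<zeta> (Suc 0))"]
  by (simp add: Q_def \<Psi>_def P_def control_def \<X>_def \<U>_def)

text \<open>
  The recovered state and control satisfy the system equation. Differentiating \<open>\<psi>(\<X>) = z\<close>
  gives \<open>d\<psi>(\<tau> \<X>) = z'\<close>, and \<open>d\<psi>(g(\<X>, \<U>)) = z'\<close> as well. So \<open>\<tau> \<X>\<close> and \<open>g(\<X>, \<U>)\<close> differ by a multiple
  of \<open>f\<^sub>k\<close>, which is what the choice of \<open>u\<^sub>k\<close> corrects.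
\<close>

lemma \<tau>_\<X>:
  assumes "\<zeta> \<in> Q"
  shows "\<tau> \<X> \<zeta> = g (\<X> \<zeta>) (control \<zeta>)"
proof -
  let ?l = "\<lambda>t. \<zeta> + t *\<^sub>R shift \<zeta>"
  have y: "(\<zeta> 0, \<zeta> (Suc 0)) \<in> V\<^sub>s" using assms by (simp add: Q_def)
  note sec = section_inverse[OF y, folded \<X>_def \<U>_def, simplified]
  have "((\<lambda>t. \<X> (?l t)) has_vector_derivative \<tau> \<X> \<zeta>) (at 0)"
    unfolding \<tau>_def by (rule outputs.dir_deriv_along_curve[OF jet_fun_\<X> outputs.tangent_line[OF assms]])
  then have "((\<lambda>t. \<psi> (\<X> (?l t))) has_vector_derivative frechet_derivative \<psi> (at (\<X> \<zeta>)) (\<tau> \<X> \<zeta>)) (at 0)"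
    by (rule has_vector_derivative_compose) (use smooth_onD(1)[OF smooth_\<psi>] sec(5) in simp)
  then have "dir_deriv (\<lambda>\<zeta>. \<psi> (\<X> \<zeta>)) \<zeta> (shift \<zeta>) = frechet_derivative \<psi> (at (\<X> \<zeta>)) (\<tau> \<X> \<zeta>)"
    by (rule dir_deriv_eqI[where F="\<lambda>\<zeta>. \<psi> (\<X> \<zeta>)"])
  moreover have "dir_deriv (\<lambda>\<zeta>. \<psi> (\<X> \<zeta>)) \<zeta> (shift \<zeta>) = dir_deriv (\<lambda>\<zeta>. \<zeta> 0) \<zeta> (shift \<zeta>)"
    by (rule outputs.dir_deriv_cong[OF assms]) (simp add: \<X>_def section_inverse(2) Q_def)
  ultimately have "frechet_derivative \<psi> (at (\<X> \<zeta>)) (\<tau> \<X> \<zeta>) = \<zeta> (Suc 0)"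
    by (simp add: outputs.dir_deriv_coord shift_def)
  moreover have "frechet_derivative \<psi> (at (\<X> \<zeta>)) (g (\<X> \<zeta>) (\<U> \<zeta>)) = \<zeta> (Suc 0)"
    using sec(3) by (simp add: z1_def)
  ultimately have "frechet_derivative \<psi> (at (\<X> \<zeta>)) (\<tau> \<X> \<zeta> - g (\<X> \<zeta>) (\<U> \<zeta>)) = 0"
    by (simp add: linear_diff[OF linear_D\<psi>[OF sec(5)]])
  then obtain c where c: "\<tau> \<X> \<zeta> - g (\<X> \<zeta>) (\<U> \<zeta>) = c *\<^sub>R f k (\<X> \<zeta>)"
    using kernel_D\<psi>[OF sec(5) surj_D\<psi>[OF sec(1)]] by blast
  \<comment> \<open>\<open>\<U>\<close> has \<open>s\<close> in place \<open>k\<close>, so the factor of \<open>f\<^sub>k\<close> in \<open>\<tau> \<X>\<close> is \<open>c + s\<close>.\<close>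
  have *: "\<tau> \<X> \<zeta> = g (\<X> \<zeta>) (set_k (c + s) (\<U> \<zeta>))"
    using c g_set_k'[of "\<X> \<zeta>" "\<U> \<zeta>"] sec(4) unfolding g_set_k[of _ "c + s"]
    by (simp add: algebra_simps)
  then show ?thesis using u\<^sub>k_eqI[OF sec(5) *] by (simp add: control_def)
qed

text \<open>
  The system equation says that \<open>\<Psi>\<close> sends the shift direction to the Cartan field of the system.
\<close>

lemma \<tau>_pullback:
  assumes "state.jet_fun G" "\<zeta> \<in> Q"
  shows "dir_deriv (\<lambda>\<zeta>. G (\<Psi> \<zeta>)) \<zeta> (shift \<zeta>) = cartan_deriv g G (\<Psi> \<zeta>)"
proof -
  let ?l = "\<lambda>t. \<zeta> + t *\<^sub>R shift \<zeta>"
  note l = outputs.tangent_line[OF assms(2), of "shift \<zeta>"]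
  have "state.tangent (\<lambda>t. \<Psi> (?l t)) (\<Psi> \<zeta>) (cartan_field g (\<Psi> \<zeta>))"
    unfolding state.tangent_def
  proof (intro conjI allI)
    show "\<Psi> \<zeta> \<in> P" using \<Psi>_P assms(2) .
    show "\<Psi> (\<zeta> + 0 *\<^sub>R shift \<zeta>) = \<Psi> \<zeta>" by simp
    show "eventually (\<lambda>t. \<Psi> (?l t) \<in> P) (nhds 0)"
    proof -
      have "eventually (\<lambda>t. ?l t \<in> Q) (nhds 0)" using l unfolding outputs.tangent_def by blast
      then show ?thesis by (rule eventually_mono) (rule \<Psi>_P)
    qed
    show "((\<lambda>t. fst (\<Psi> (?l t))) has_vector_derivative fst (cartan_field g (\<Psi> \<zeta>))) (at 0)"
      using outputs.dir_deriv_along_curve[OF jet_fun_\<X> l] \<tau>_\<X>[OF assms(2)]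
      by (simp add: \<Psi>_def cartan_field_def \<tau>_def)
    show "((\<lambda>t. snd (\<Psi> (?l t)) j) has_vector_derivative snd (cartan_field g (\<Psi> \<zeta>)) j) (at 0)" for j
      using outputs.dir_deriv_along_curve[OF jet_fun_control_derivatives[of j] l]
      by (simp add: \<Psi>_def cartan_field_def \<tau>_def)
  qed
  from state.dir_deriv_along_curve[OF assms(1) this] show ?thesis
    unfolding cartan_deriv_def by (rule dir_deriv_eqI[where F="\<lambda>\<zeta>. G (\<Psi> \<zeta>)"])
qed

text \<open>
  Order zero is \<open>\<psi>(\<X>) = z\<close>; each further order follows by differentiating the preceding one.
\<close>

lemma Z_\<Psi>:
  assumes "\<zeta> \<in> Q"
  shows "Z (\<Psi> \<zeta>) = \<zeta>"
proof -
  have "Z (\<Psi> \<zeta>) j = \<zeta> j" if "\<zeta> \<in> Q" for \<zeta> j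
    using that
  proof (induction j arbitrary: \<zeta>)
    case 0
    then show ?case using section_inverse(2) by (simp add: Z_0 \<Psi>_def \<X>_def Q_def)
  next
    case (Suc j)
    have "Z (\<Psi> \<zeta>) (Suc j) = dir_deriv (\<lambda>\<zeta>. Z (\<Psi> \<zeta>) j) \<zeta> (shift \<zeta>)"
      using \<tau>_pullback[OF jet_fun_Z Suc.prems] by (simp add: Z_Suc)
    also have "\<dots> = dir_deriv (\<lambda>\<zeta>. \<zeta> j) \<zeta> (shift \<zeta>)"
      by (rule outputs.dir_deriv_cong[OF Suc.prems]) (rule Suc.IH)
    also have "\<dots> = \<zeta> (Suc j)" by (simp add: outputs.dir_deriv_coord shift_def)
    finally show ?case .
  qed
  then show ?thesis using assms by blast
qed

theorem jet_diffeomorphism_Z: "jet_diffeomorphism P Q Z"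
  unfolding jet_diffeomorphism_def
proof (intro exI[of _ \<Psi>] conjI allI)
  show "homeomorphism P Q Z \<Psi>"
  proof (rule homeomorphismI)
    show "continuous_on P Z"
      by (rule continuous_on_coordinatewise_then_product[OF state.jet_fun_continuous[OF jet_fun_Z]])
    show "continuous_on Q \<Psi>"
      unfolding \<Psi>_def
      by (intro continuous_on_Pair continuous_on_coordinatewise_then_product outputs.jet_fun_continuous
          jet_fun_\<X> jet_fun_control_derivatives)
  qed (use Z_Q \<Psi>_P Z_\<Psi> \<Psi>_Z in auto)
  show "jet_smooth_on state_coords P (\<lambda>p. Z p j)" for j
    by (rule state.jet_fun_smooth[OF jet_fun_Z])
  show "jet_smooth_on out_coords Q (\<lambda>\<zeta>. fst (\<Psi> \<zeta>))"
    using outputs.jet_fun_smooth[OF jet_fun_\<X>] by (simp add: \<Psi>_def)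
  show "jet_smooth_on out_coords Q (\<lambda>\<zeta>. snd (\<Psi> \<zeta>) j)" for j
    using outputs.jet_fun_smooth[OF jet_fun_control_derivatives[of j]] by (simp add: \<Psi>_def)
qed

end

context first_integrals_chart
begin

theorem prolongation_jet_diffeomorphism:
  assumes "\<xi>\<^sub>0 \<in> S" "surj (frechet_derivative \<psi> (at \<xi>\<^sub>0))"
    and "dim (span (range (\<lambda>j. f j \<xi>\<^sub>0) \<union> {lie_bracket (\<lambda>\<xi>. g \<xi> (w 0)) (f k) \<xi>\<^sub>0})) = CARD('n)"
  shows "\<exists>P Q. open P \<and> open Q \<and> (\<xi>\<^sub>0, w) \<in> P \<and> P \<subseteq> S \<times> UNIV \<and>
    jet_diffeomorphism P Q (prolongation g (\<lambda>p. \<psi> (fst p)))"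
proof -
  obtain D V \<Theta> where D: "open D" "(\<xi>\<^sub>0, w 0) \<in> D" "D \<subseteq> S \<times> UNIV" "open V" "homeomorphism D V \<Phi> \<Theta>"
    "smooth_on V \<Theta>" "\<And>p. p \<in> D \<Longrightarrow> bij (frechet_derivative \<Phi> (at p))"
    using smooth_inverse_function_theorem[OF open_SU _ smooth_\<Phi> _ inj_derivative_\<Phi>[OF assms]] assms(1) card
    by auto
  \<comment> \<open>The reference value of \<open>u\<^sub>k\<close> is its value at the given point.\<close>
  interpret local_first_jet_inverse S f\<^sub>0 f k \<psi> D V \<Theta> "w 0 $ k"
    using D by unfold_locales auto
  show ?thesis
    using open_P open_Q P_S jet_diffeomorphism_Z D(2) unfolding Z_def
    by (intro exI[of _ P] exI[of _ Q]) (auto simp: P_def)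
qed

end

section \<open>Passage to the manifold\<close>

lemma sum_fun_apply: "(\<Sum>i\<in>I. F i) x = (\<Sum>i\<in>I. F i x)"
  for F :: "'i \<Rightarrow> 'a \<Rightarrow> 'b::comm_monoid_add"
  by (induction I rule: infinite_finite_induct) simp_all

text \<open>
  A nonzero vector orthogonal to the range would be a vector of coefficients of a linear relation
  between the components.
\<close>

lemma independent_functionals_surj:
  fixes L :: "'a::euclidean_space \<Rightarrow> real ^ 'm"
  assumes lin: "linear L" and ind: "independent_family (\<lambda>i v. L v $ i)"
  shows "surj L"
proof (rule ccontr)
  assume "\<not> surj L"
  have "dim (range L) < DIM(real ^ 'm)"
  proof (rule ccontr)
    assume "\<not> ?thesis"
    then have "dim (range L) = DIM(real ^ 'm)" using dim_subset_UNIV[of "range L"] by simp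
    then have "span (range L) = UNIV" using dim_eq_full by blast
    then show False
      using \<open>\<not> surj L\<close> linear_subspace_image[OF lin subspace_UNIV] span_eq_iff by metis
  qed
  then obtain y where y: "y \<noteq> 0" "\<And>z. z \<in> span (range L) \<Longrightarrow> orthogonal y z"
    using orthogonal_to_subspace_exists by blast
  let ?D = "\<lambda>i v. L v $ i"
  have inj: "inj ?D" and indep: "independent (range ?D)" using ind by (auto simp: independent_family_def)
  have "(\<Sum>h\<in>range ?D. y $ inv ?D h *\<^sub>R h) = (\<Sum>i\<in>UNIV. y $ i *\<^sub>R ?D i)"
    by (simp add: sum.reindex[OF inj] inv_f_f[OF inj])
  also have "\<dots> = 0"
  proof
    fix v
    have "(\<Sum>i\<in>UNIV. y $ i *\<^sub>R ?D i) v = y \<bullet> L v"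
      by (simp add: sum_fun_apply scaleR_fun_def inner_vec_def)
    also have "\<dots> = 0" using y(2)[OF span_base[OF rangeI]] by (simp add: orthogonal_def)
    finally show "(\<Sum>i\<in>UNIV. y $ i *\<^sub>R ?D i) v = 0 v" by simp
  qed
  finally have 0: "(\<Sum>h\<in>range ?D. y $ inv ?D h *\<^sub>R h) = 0" .
  have "y $ inv ?D (?D i) = 0" for i
    by (rule independentD[OF indep _ order_refl 0]) auto
  then have "y = 0" by (simp add: vec_eq_iff inv_f_f[OF inj])
  then show False using y(1) by simp
qed

text \<open>
  A right inverse of the derivative at the base point turns surjectivity into injectivity of a
  continuous family of linear maps.
\<close>

lemma surj_derivative_near:
  fixes \<psi> :: "'a::euclidean_space \<Rightarrow> 'b::euclidean_space"
  assumes "open S" "\<xi>\<^sub>0 \<in> S" and \<psi>: "smooth_on S \<psi>" and surj: "surj (frechet_derivative \<psi> (at \<xi>\<^sub>0))"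
  obtains U where "open U" "\<xi>\<^sub>0 \<in> U" "U \<subseteq> S" "\<And>\<xi>. \<xi> \<in> U \<Longrightarrow> surj (frechet_derivative \<psi> (at \<xi>))"
proof -
  let ?D = "\<lambda>\<xi>. frechet_derivative \<psi> (at \<xi>)"
  have lin: "linear (?D \<xi>)" if "\<xi> \<in> S" for \<xi>
    using smooth_onD(1)[OF \<psi> that] has_derivative_linear by blast
  obtain R where R: "linear R" "?D \<xi>\<^sub>0 \<circ> R = id"
    using linear_surjective_right_inverse[OF lin[OF assms(2)] surj] by blast
  have linT: "linear (\<lambda>b. ?D \<xi> (R b))" if "\<xi> \<in> S" for \<xi>
    using linear_compose[OF R(1) lin[OF that]] by (simp add: o_def)
  have "inj (\<lambda>b. ?D \<xi>\<^sub>0 (R b))" using fun_cong[OF R(2)] by (simp add: inj_def)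
  then obtain B U where U: "B > 0" "open U" "\<xi>\<^sub>0 \<in> U" "U \<subseteq> S" "\<And>\<xi> b. \<xi> \<in> U \<Longrightarrow> B * norm b \<le> norm (?D \<xi> (R b))"
    using linear_family_bounded_below[OF assms(1,2) linT _ smooth_onD(2)[OF smooth_onD(3)[OF \<psi>]]] by blast
  have "surj (?D \<xi>)" if \<xi>: "\<xi> \<in> U" for \<xi>
  proof -
    have lT: "linear (\<lambda>b. ?D \<xi> (R b))" using linT \<xi> U(4) by blast
    have "b = 0" if "?D \<xi> (R b) = 0" for b
      using U(5)[OF \<xi>, of b] that U(1) by (simp add: mult_le_0_iff)
    then have "inj (\<lambda>b. ?D \<xi> (R b))" using linear_injective_0[OF lT] by blast
    then have "surj (\<lambda>b. ?D \<xi> (R b))" using linear_injective_imp_surjective[OF lT] by simp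
    then show ?thesis unfolding surj_def by blast
  qed
  then show ?thesis using that U by blast
qed

lemma chart_inv_map:
  assumes "smooth_atlas A" "c \<in> A" "x \<in> chart_dom c"
  shows "chart_inv c (chart_map c x) = x"
  using assms by (auto simp: smooth_atlas_def homeomorphism_def)

lemma open_chart_image:
  assumes A: "smooth_atlas A" "c \<in> A" and N: "open N"
  shows "open (chart_map c ` (chart_dom c \<inter> N))"
proof -
  have c: "open (chart_map c ` chart_dom c)"
    "homeomorphism (chart_dom c) (chart_map c ` chart_dom c) (chart_map c) (chart_inv c)"
    using A by (auto simp: smooth_atlas_def)
  have "openin (top_of_set (chart_dom c)) (chart_dom c \<inter> N)" using N by (rule openin_open_Int)
  from homeomorphism_imp_open_map[OF c(2) this] show ?thesis
    using c(1) openin_open_eq by blast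
qed

definition local_tuple :: "('m::finite \<Rightarrow> 'a \<Rightarrow> real) \<Rightarrow> ('a, 'n::finite) chart \<Rightarrow> real ^ 'n \<Rightarrow> real ^ 'm" where
  "local_tuple \<psi> c \<xi> = (\<chi> i. \<psi> i (chart_inv c \<xi>))"

lemma smooth_local_tuple:
  fixes \<psi> :: "'m::finite \<Rightarrow> 'a \<Rightarrow> real"
  assumes "open S" "\<And>i. smooth_on S (\<psi> i \<circ> chart_inv c)"
  shows "smooth_on S (local_tuple \<psi> c)"
proof (rule smooth_on_componentwise[OF assms(1)])
  fix b :: "real ^ 'm" assume "b \<in> Basis"
  then obtain i where "b = axis i 1" by (auto simp: Basis_vec_def)
  then have "(\<lambda>\<xi>. local_tuple \<psi> c \<xi> \<bullet> b) = \<psi> i \<circ> chart_inv c"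
    by (simp add: local_tuple_def inner_axis fun_eq_iff)
  then show "smooth_on S (\<lambda>\<xi>. local_tuple \<psi> c \<xi> \<bullet> b)" using assms(2) by simp
qed

lemma derivative_local_tuple:
  assumes "smooth_on S (local_tuple \<psi> c)" "\<xi> \<in> S"
  shows "frechet_derivative (local_tuple \<psi> c) (at \<xi>) v $ i = frechet_derivative (\<psi> i \<circ> chart_inv c) (at \<xi>) v"
  using frechet_derivative_bounded_linear[OF smooth_onD(1)[OF assms] bounded_linear_vec_nth, of i v]
  by (simp add: local_tuple_def o_def)

text \<open>
  The derivative in the chart \<open>c\<close> factors through the derivative in the chart \<open>d\<close>, so the range of
  the latter is at least as large.
\<close>

lemma surj_derivative_change_chart:
  assumes A: "smooth_atlas A" "c \<in> A" "d \<in> A" and x: "x \<in> chart_dom c" "x \<in> chart_dom d" "x \<in> N" and N: "open N"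
    and smooth: "\<And>e. e \<in> A \<Longrightarrow> smooth_on (chart_map e ` (chart_dom e \<inter> N)) (local_tuple \<psi> e)"
    and surj: "surj (frechet_derivative (local_tuple \<psi> c) (at (chart_map c x)))"
  shows "surj (frechet_derivative (local_tuple \<psi> d) (at (chart_map d x)))"
proof -
  let ?T = "chart_map d \<circ> chart_inv c" and ?O = "chart_map c ` (chart_dom c \<inter> (chart_dom d \<inter> N))"
  have "open (chart_dom d)" using A by (auto simp: smooth_atlas_def)
  then have O: "open ?O" using N by (intro open_chart_image[OF A(1,2)]) auto
  have xO: "chart_map c x \<in> ?O" using x by blast
  have Tx: "?T (chart_map c x) = chart_map d x" using chart_inv_map[OF A(1,2) x(1)] by simp
  have "smooth_on (chart_map c ` (chart_dom c \<inter> chart_dom d)) ?T"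
    using A unfolding smooth_atlas_def by blast
  then have dT: "(?T has_derivative frechet_derivative ?T (at (chart_map c x))) (at (chart_map c x))"
    by (rule smooth_onD(1)) (use x in blast)
  have d\<psi>: "(local_tuple \<psi> d has_derivative frechet_derivative (local_tuple \<psi> d) (at (chart_map d x))) (at (?T (chart_map c x)))"
    unfolding Tx by (rule smooth_onD(1)[OF smooth[OF A(3)]]) (use x in blast)
  have "local_tuple \<psi> c \<xi> = (local_tuple \<psi> d \<circ> ?T) \<xi>" if "\<xi> \<in> ?O" for \<xi>
    using that chart_inv_map[OF A(1,2)] chart_inv_map[OF A(1,3)] by (auto simp: local_tuple_def)
  then have "frechet_derivative (local_tuple \<psi> c) (at (chart_map c x)) =
      frechet_derivative (local_tuple \<psi> d \<circ> ?T) (at (chart_map c x))"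
    by (rule frechet_derivative_cong[OF O xO])
  also have "\<dots> = frechet_derivative (local_tuple \<psi> d) (at (chart_map d x)) \<circ> frechet_derivative ?T (at (chart_map c x))"
    by (rule frechet_derivative_at[OF diff_chain_at[OF dT d\<psi>], symmetric])
  finally show ?thesis using surj unfolding surj_def by (metis comp_apply)
qed

theorem theorem3:
  fixes A :: "('a::{t2_space, second_countable_topology}, 'n::finite) chart set"
    and f\<^sub>0 :: "('a, 'n) vfield"
    and f :: "'m::finite \<Rightarrow> ('a, 'n) vfield"
    and k :: 'm
    and x\<^sub>0 :: 'a and u\<^sub>0 :: "real ^ 'm"
    and W :: "('a \<times> (real ^ 'm)) set"
    and \<psi> :: "'m \<Rightarrow> 'a \<Rightarrow> real"
  assumes "smooth_atlas A"
    and "CARD('n) \<ge> 2" and "CARD('m) = CARD('n) - 1"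
    and "smooth_vector_field A f\<^sub>0"
    and "\<And>j. smooth_vector_field A (f j)"
    and "generically_independent A f"
    and "open W" and "(x\<^sub>0, u\<^sub>0) \<in> W"
    and "\<And>x u c. (x, u) \<in> W \<Longrightarrow> c \<in> A \<Longrightarrow> x \<in> chart_dom c \<Longrightarrow>
           dim (span (range (\<lambda>j. f j c (chart_map c x)) \<union>
             {lie_bracket (\<lambda>\<xi>. control_affine f\<^sub>0 f c \<xi> u) (f k c) (chart_map c x)})) = CARD('n)"
    and "\<And>i. first_integral_near A (f k) x\<^sub>0 (\<psi> i)"
    and "independent_differentials_at A x\<^sub>0 \<psi>"
  shows "\<exists>W'. open W' \<and> (x\<^sub>0, u\<^sub>0) \<in> W' \<and>
           (\<forall>x U. (x, U 0) \<in> W' \<longrightarrow>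
              flat_output_near A f\<^sub>0 f (\<lambda>p. \<chi> i. \<psi> i (fst p)) (x, U))"
proof -
  note A = assms(1)
  have card: "CARD('n) = CARD('m) + 1" using assms(2,3) by simp
  obtain N' where N': "\<And>i. open (N' i)" "\<And>i. x\<^sub>0 \<in> N' i" "\<And>i. smooth_function_on A (N' i) (\<psi> i)"
    "\<And>i x c. x \<in> N' i \<Longrightarrow> c \<in> A \<Longrightarrow> x \<in> chart_dom c \<Longrightarrow>
      lie_derivative (f k c) (\<psi> i \<circ> chart_inv c) (chart_map c x) = 0"
    using assms(10) unfolding first_integral_near_def by metis
  define N where "N = (\<Inter>i. N' i)"
  have N: "open N" "x\<^sub>0 \<in> N" using N' by (auto simp: N_def)
  have smooth: "smooth_on (chart_map c ` (chart_dom c \<inter> N)) (local_tuple \<psi> c)" if c: "c \<in> A" for c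
  proof (rule smooth_local_tuple[OF open_chart_image[OF A c N(1)]])
    fix i
    have "smooth_on (chart_map c ` (chart_dom c \<inter> N' i)) (\<psi> i \<circ> chart_inv c)"
      using N'(3) c by (simp add: smooth_function_on_def)
    then show "smooth_on (chart_map c ` (chart_dom c \<inter> N)) (\<psi> i \<circ> chart_inv c)"
      by (rule smooth_on_subset) (auto simp: N_def)
  qed
  obtain c\<^sub>0 where c0: "c\<^sub>0 \<in> A" "x\<^sub>0 \<in> chart_dom c\<^sub>0" using A unfolding smooth_atlas_def by blast
  let ?S0 = "chart_map c\<^sub>0 ` (chart_dom c\<^sub>0 \<inter> N)"
  have x0: "chart_map c\<^sub>0 x\<^sub>0 \<in> ?S0" using c0 N by blast
  have "surj (frechet_derivative (local_tuple \<psi> c\<^sub>0) (at (chart_map c\<^sub>0 x\<^sub>0)))"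
  proof (rule independent_functionals_surj)
    show "linear (frechet_derivative (local_tuple \<psi> c\<^sub>0) (at (chart_map c\<^sub>0 x\<^sub>0)))"
      using smooth_onD(1)[OF smooth[OF c0(1)] x0] by (rule has_derivative_linear)
    show "independent_family (\<lambda>i v. frechet_derivative (local_tuple \<psi> c\<^sub>0) (at (chart_map c\<^sub>0 x\<^sub>0)) v $ i)"
      using assms(11) c0 unfolding independent_differentials_at_def
      by (simp add: derivative_local_tuple[OF smooth[OF c0(1)] x0])
  qed
  then obtain O\<^sub>0 where O0: "open O\<^sub>0" "chart_map c\<^sub>0 x\<^sub>0 \<in> O\<^sub>0" "O\<^sub>0 \<subseteq> ?S0"
    "\<And>\<xi>. \<xi> \<in> O\<^sub>0 \<Longrightarrow> surj (frechet_derivative (local_tuple \<psi> c\<^sub>0) (at \<xi>))"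
    using surj_derivative_near[OF open_chart_image[OF A c0(1) N(1)] x0 smooth[OF c0(1)]] by blast
  \<comment> \<open>Independence of the differentials spreads to a neighbourhood of \<open>x\<^sub>0\<close> in one chart, and from there
    to all charts around its points.\<close>
  define M where "M = chart_dom c\<^sub>0 \<inter> chart_map c\<^sub>0 -` O\<^sub>0"
  have "open M"
  proof -
    have "continuous_on (chart_dom c\<^sub>0) (chart_map c\<^sub>0)" "open (chart_dom c\<^sub>0)"
      using A c0 by (auto simp: smooth_atlas_def homeomorphism_def)
    then show ?thesis unfolding M_def using O0(1) by (rule continuous_open_preimage)
  qed
  have M: "x \<in> N" "surj (frechet_derivative (local_tuple \<psi> c) (at (chart_map c x)))"
    if x: "x \<in> M" "c \<in> A" "x \<in> chart_dom c" for x c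
  proof -
    have "x \<in> chart_dom c\<^sub>0" "chart_map c\<^sub>0 x \<in> ?S0" using x O0(3) by (auto simp: M_def)
    then show "x \<in> N" using chart_inv_map[OF A c0(1)] by (metis (no_types, lifting) IntE imageE)
    then show "surj (frechet_derivative (local_tuple \<psi> c) (at (chart_map c x)))"
      using surj_derivative_change_chart[OF A c0(1) x(2) _ x(3) _ N(1) smooth] O0(4) x by (simp add: M_def)
  qed
  have flat: "flat_output_near A f\<^sub>0 f (\<lambda>p. \<chi> i. \<psi> i (fst p)) (x, U)"
    if W: "(x, U 0) \<in> W" and x: "x \<in> M" for x U
    unfolding flat_output_near_def fst_conv snd_conv
  proof (intro ballI impI)
    fix c assume c: "c \<in> A" "x \<in> chart_dom c"
    let ?S1 = "chart_map c ` (chart_dom c \<inter> N)"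
    \<comment> \<open>At the given point \<open>f\<^sub>k\<close> is nonzero by the rank condition; where it vanishes is cut off.\<close>
    define S where "S = ?S1 \<inter> f k c -` (- {0})"
    have S1: "open ?S1" by (rule open_chart_image[OF A c(1) N(1)])
    have sub: "?S1 \<subseteq> chart_map c ` chart_dom c" by blast
    have sf: "smooth_on ?S1 (f j c)" "smooth_on ?S1 (f\<^sub>0 c)" for j
      using assms(4,5) c(1) smooth_on_subset[OF _ sub] unfolding smooth_vector_field_def by blast+
    have "open S"
      unfolding S_def by (rule continuous_open_preimage[OF smooth_onD(2)[OF sf(1)] S1]) auto
    note rank = assms(9)[OF W c]
    have nonzero: "f k c (chart_map c x) \<noteq> 0"
    proof
      assume "f k c (chart_map c x) = 0"
      then have "(\<Sum>j\<in>UNIV. axis k (1::real) $ j *\<^sub>R f j c (chart_map c x)) + 0 *\<^sub>R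
        lie_bracket (\<lambda>\<xi>. control_affine f\<^sub>0 f c \<xi> (U 0)) (f k c) (chart_map c x) = 0"
        by (auto simp: axis_def intro!: sum.neutral)
      from spanning_family_independent[OF _ _ this] rank card show False by (simp add: axis_eq_0_iff)
    qed
    have \<xi>0: "chart_map c x \<in> S" using nonzero c M(1)[OF x c] by (auto simp: S_def)
    interpret first_integrals_chart S "f\<^sub>0 c" "\<lambda>j. f j c" k "local_tuple \<psi> c"
    proof
      have S: "S \<subseteq> ?S1" by (auto simp: S_def)
      show "open S" by fact
      show "smooth_on S (f\<^sub>0 c)" "smooth_on S (f j c)" "smooth_on S (local_tuple \<psi> c)" for j
        using sf smooth[OF c(1)] smooth_on_subset[OF _ S] by blast+
      show "CARD('n) = CARD('m) + 1" by (rule card)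
      fix \<xi> assume "\<xi> \<in> S"
      then show "f k c \<xi> \<noteq> 0" by (simp add: S_def)
      obtain y where y: "y \<in> chart_dom c" "y \<in> N" "\<xi> = chart_map c y" using \<open>\<xi> \<in> S\<close> by (auto simp: S_def)
      have "\<xi> \<in> ?S1" using \<open>\<xi> \<in> S\<close> S by blast
      have "frechet_derivative (local_tuple \<psi> c) (at \<xi>) (f k c \<xi>) $ i = 0" for i
        using N'(4)[of y i c] y c(1) derivative_local_tuple[OF smooth[OF c(1)] \<open>\<xi> \<in> ?S1\<close>]
        by (simp add: lie_derivative_def N_def)
      then show "frechet_derivative (local_tuple \<psi> c) (at \<xi>) (f k c \<xi>) = 0" by (simp add: vec_eq_iff)
    qed
    have g: "control_affine f\<^sub>0 f c = g" by (simp add: fun_eq_iff control_affine_def g_def)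
    have out: "(\<lambda>q. \<chi> i. \<psi> i (chart_inv c (fst q))) = (\<lambda>q. local_tuple \<psi> c (fst q))"
      by (simp add: local_tuple_def)
    obtain P Q where "open P" "open Q" "(chart_map c x, U) \<in> P" "P \<subseteq> S \<times> UNIV"
      "jet_diffeomorphism P Q (prolongation g (\<lambda>q. local_tuple \<psi> c (fst q)))"
      using prolongation_jet_diffeomorphism[OF \<xi>0 M(2)[OF x c], of U] rank unfolding g by blast
    moreover have "S \<times> UNIV \<subseteq> (chart_map c ` chart_dom c) \<times> UNIV" by (auto simp: S_def)
    ultimately have "\<exists>P Q. open P \<and> open Q \<and> (chart_map c x, U) \<in> P \<and>
           P \<subseteq> (chart_map c ` chart_dom c) \<times> UNIV \<and>
           jet_diffeomorphism P Q (prolongation g (\<lambda>q. local_tuple \<psi> c (fst q)))"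
      by (intro exI[of _ P] exI[of _ Q] conjI) (assumption | blast)+
    then show "\<exists>P Q. open P \<and> open Q \<and> (chart_map c x, U) \<in> P \<and>
           P \<subseteq> (chart_map c ` chart_dom c) \<times> UNIV \<and>
           jet_diffeomorphism P Q (prolongation (control_affine f\<^sub>0 f c) (\<lambda>q. \<chi> i. \<psi> i (chart_inv c (fst q))))"
      unfolding g out .
  qed
  show ?thesis
  proof (intro exI[of _ "W \<inter> (M \<times> UNIV)"] conjI allI impI)
    show "open (W \<inter> (M \<times> UNIV))" using assms(7) \<open>open M\<close> by (intro open_Int open_Times) auto
    show "(x\<^sub>0, u\<^sub>0) \<in> W \<inter> (M \<times> UNIV)" using assms(8) c0 O0(2) by (simp add: M_def)
  qed (use flat in auto)
qed

end
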